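(* Let $\Omega\subset\mathbb{C}^n$ be a smoothly bounded pseudoconvex domain and let $p>2$. Suppose that there exists $r\in[p,\infty)$ such that $\mathbf{B}:L^r(\Omega)\to A^p(\Omega)$ is bounded. Then $\mathbf{F}:A^2(\Omega)\to A^p(\Omega)$ is bounded. Moreover, there is a constant $C>0$ such that for every $g\in A^2(\Omega)$, \[ \|\mathbf{F}(g)\|_{L^p(\Omega)}\le C\|g\|_{L^1(\Omega)}. \]
   Context: For a bounded domain $\Omega\subset\mathbb{C}^n$, $\mathcal{O}(\Omega)$ is the space of holomorphic functions on $\Omega$, and for $1\le p<\infty$, $A^p(\Omega)=L^p(\Omega)\cap\mathcal{O}(\Omega)$ (with respect to Lebesgue measure, with the $L^p$ norm). The Bergman projection $\mathbf{B}$ is the orthogonal projection from $L^2(\Omega)$ onto $A^2(\Omega)$. The Friedrichs operator is the conjugate-linear map $\mathbf{F}:A^2(\Omega)\to A^2(\Omega)$, $\mathbf{F}(g)=\mathbf{B}(\overline{g})$. "Smoothly bounded" means bounded with $C^\infty$ boundary. An operator $T:X\to Y$ is bounded if it maps $X$ into $Y$ with $\|Tx\|_Y\le C\|x\|_X$ for some constant $C$ and all $x\in X$. *)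

theory Defs
  imports "HOL-Analysis.Analysis"
begin

section \<open>Smoothly bounded pseudoconvex domains\<close>

text \<open>\<open>C\<^sup>k\<close> functions on an open set, through iterated directional derivatives.\<close>

fun Ck_on :: "nat \<Rightarrow> ('a::real_normed_vector \<Rightarrow> 'b::real_normed_vector) \<Rightarrow> 'a set \<Rightarrow> bool" where
  "Ck_on 0 f S \<longleftrightarrow> continuous_on S f"
| "Ck_on (Suc k) f S \<longleftrightarrow>
     (\<forall>x\<in>S. f differentiable (at x)) \<and> (\<forall>v. Ck_on k (\<lambda>x. frechet_derivative f (at x) v) S)"

definition smooth_on :: "('a::real_normed_vector \<Rightarrow> 'b::real_normed_vector) \<Rightarrow> 'a set \<Rightarrow> bool" where
  "smooth_on f S \<longleftrightarrow> (\<forall>k. Ck_on k f S)"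

text \<open>The boundary is smooth when there is a smooth defining function on a neighbourhood of it;
  only the values of \<open>\<rho>\<close> on \<open>U\<close> matter.\<close>

definition smooth_boundary :: "(complex ^ 'n) set \<Rightarrow> bool" where
  "smooth_boundary \<Omega> \<longleftrightarrow>
     (\<exists>U (\<rho> :: complex ^ 'n \<Rightarrow> real). open U \<and> frontier \<Omega> \<subseteq> U \<and> smooth_on \<rho> U \<and>
        \<Omega> \<inter> U = {z \<in> U. \<rho> z < 0} \<and>
        (\<forall>z\<in>frontier \<Omega>. frechet_derivative \<rho> (at z) \<noteq> (\<lambda>v. 0)))"

definition smoothly_bounded_domain :: "(complex ^ 'n) set \<Rightarrow> bool" where
  "smoothly_bounded_domain \<Omega> \<longleftrightarrow>
     open \<Omega> \<and> connected \<Omega> \<and> \<Omega> \<noteq> {} \<and> bounded \<Omega> \<and> smooth_boundary \<Omega>"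

text \<open>Continuous plurisubharmonic functions: the sub-mean value inequality holds on the boundary
  circle of every closed complex disc \<open>{z + \<zeta>w : |\<zeta>| \<le> 1}\<close> contained in \<open>\<Omega>\<close>.\<close>

definition continuous_plurisubharmonic_on ::
    "(complex ^ 'n \<Rightarrow> real) \<Rightarrow> (complex ^ 'n) set \<Rightarrow> bool" where
  "continuous_plurisubharmonic_on \<phi> \<Omega> \<longleftrightarrow>
     continuous_on \<Omega> \<phi> \<and>
     (\<forall>z w. (\<forall>\<zeta>. norm \<zeta> \<le> 1 \<longrightarrow> z + \<zeta> *s w \<in> \<Omega>) \<longrightarrow>
        \<phi> z \<le> 1 / (2 * pi) * integral {0..2 * pi} (\<lambda>t. \<phi> (z + cis t *s w)))"

definition pseudoconvex :: "(complex ^ 'n) set \<Rightarrow> bool" where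
  "pseudoconvex \<Omega> \<longleftrightarrow>
     (\<exists>\<phi>. continuous_plurisubharmonic_on \<phi> \<Omega> \<and> (\<forall>c. compact {z \<in> \<Omega>. \<phi> z \<le> c}))"

section \<open>Bergman spaces\<close>

text \<open>Holomorphic: at every point there is a Frechet derivative, and it is complex linear.\<close>

definition holomorphic_in :: "(complex ^ 'n \<Rightarrow> complex) \<Rightarrow> (complex ^ 'n) set \<Rightarrow> bool" where
  "holomorphic_in f \<Omega> \<longleftrightarrow>
     (\<forall>z\<in>\<Omega>. \<exists>L. (f has_derivative L) (at z) \<and> (\<forall>c v. L (c *s v) = c * L v))"

text \<open>Elements of \<open>L\<^sup>p\<close> are represented by functions, not by almost-everywhere classes; their
  values outside \<open>\<Omega>\<close> are irrelevant.\<close>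

definition Lp :: "real \<Rightarrow> (complex ^ 'n) set \<Rightarrow> (complex ^ 'n \<Rightarrow> complex) set" where
  "Lp p \<Omega> = {f. f \<in> borel_measurable (lebesgue_on \<Omega>) \<and>
                integrable (lebesgue_on \<Omega>) (\<lambda>z. norm (f z) powr p)}"

definition Lp_norm :: "real \<Rightarrow> (complex ^ 'n) set \<Rightarrow> (complex ^ 'n \<Rightarrow> complex) \<Rightarrow> real" where
  "Lp_norm p \<Omega> f = (LINT z|lebesgue_on \<Omega>. norm (f z) powr p) powr (1 / p)"

definition Ap :: "real \<Rightarrow> (complex ^ 'n) set \<Rightarrow> (complex ^ 'n \<Rightarrow> complex) set" where
  "Ap p \<Omega> = Lp p \<Omega> \<inter> {f. holomorphic_in f \<Omega>}"

definition L2_inner ::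
    "(complex ^ 'n) set \<Rightarrow> (complex ^ 'n \<Rightarrow> complex) \<Rightarrow> (complex ^ 'n \<Rightarrow> complex) \<Rightarrow> complex" where
  "L2_inner \<Omega> f g = (LINT z|lebesgue_on \<Omega>. f z * cnj (g z))"

text \<open>The orthogonal projection of \<open>f\<close> onto \<open>A\<^sup>2(\<Omega>)\<close>; it is determined on \<open>\<Omega>\<close>, and the
  convention that it vanishes outside \<open>\<Omega>\<close> makes it unique as a function.\<close>

definition bergman_projection ::
    "(complex ^ 'n) set \<Rightarrow> (complex ^ 'n \<Rightarrow> complex) \<Rightarrow> complex ^ 'n \<Rightarrow> complex" where
  "bergman_projection \<Omega> f =
     (THE h. h \<in> Ap 2 \<Omega> \<and> (\<forall>z. z \<notin> \<Omega> \<longrightarrow> h z = 0) \<and>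
             (\<forall>k\<in>Ap 2 \<Omega>. L2_inner \<Omega> (\<lambda>z. f z - h z) k = 0))"

definition friedrichs_operator ::
    "(complex ^ 'n) set \<Rightarrow> (complex ^ 'n \<Rightarrow> complex) \<Rightarrow> complex ^ 'n \<Rightarrow> complex" where
  "friedrichs_operator \<Omega> g = bergman_projection \<Omega> (\<lambda>z. cnj (g z))"

definition bounded_operator ::
    "'a set \<Rightarrow> ('a \<Rightarrow> real) \<Rightarrow> 'b set \<Rightarrow> ('b \<Rightarrow> real) \<Rightarrow> ('a \<Rightarrow> 'b) \<Rightarrow> bool" where
  "bounded_operator X normX Y normY T \<longleftrightarrow>
     (\<exists>C. \<forall>x\<in>X. T x \<in> Y \<and> normY (T x) \<le> C * normX x)"

end

theory Submission
  imports Defs "HOL-Complex_Analysis.Cauchy_Integral_Formula"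
begin

text \<open>
  For \<open>g\<close> and \<open>k\<close> in \<open>A\<^sup>2(\<Omega>)\<close>, the inner product of the conjugate of \<open>g\<close> with \<open>k\<close> is the conjugate of
  \<open>\<integral>\<^sub>\<Omega> gk\<close>, the integral of an integrable holomorphic function. Such integrals hardly see the boundary:
  there is one continuous weight \<open>\<psi>\<close>, vanishing on the boundary to order \<open>2n\<close>, with
  \<open>\<integral>\<^sub>\<Omega> h = \<integral>\<^sub>\<Omega> h\<psi>\<close> for every integrable holomorphic \<open>h\<close>. So the conjugates of \<open>g\<close> and of \<open>g\<psi>\<close> have the
  same inner products with all of \<open>A\<^sup>2(\<Omega>)\<close>, hence the same Bergman projection, and \<open>\<^bold>F(g)\<close> is the
  projection of the conjugate of \<open>g\<psi>\<close>. But \<open>g\<psi>\<close> is bounded by a multiple of the \<open>L\<^sup>1\<close> norm of \<open>g\<close>,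
  because \<open>\<bar>g(z)\<bar>\<close> is at most a constant times that norm divided by the \<open>2n\<close>-th power of the distance
  from \<open>z\<close> to the boundary. As \<open>\<Omega>\<close> has finite measure, the \<open>L\<^sup>r\<close> norm of \<open>g\<psi>\<close> is controlled as well,
  and the boundedness of the projection from \<open>L\<^sup>r\<close> to \<open>A\<^sup>p\<close> gives the \<open>L\<^sup>1\<close> estimate. The \<open>A\<^sup>2\<close> estimate
  follows from it by the Cauchy-Schwarz inequality.

  The weight comes from a defining function \<open>s\<close>, positive in \<open>\<Omega>\<close> and zero on the boundary, whose
  derivative does not vanish there. As \<open>s\<^sup>2\<close> plus the squared length of the antiholomorphic gradient of
  \<open>s\<close> has no zero on the closure, one can divide by it and obtain functions with
  \<open>\<Sum>\<^sub>j w\<^sub>j \<partial>s/\<partial>\<zeta>\<^sub>j + s e = 1\<close>, where \<open>\<zeta>\<^sub>j\<close> is the conjugate of \<open>z\<^sub>j\<close> (lemma \<open>transversal_fields\<close>). The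
  derivative of \<open>s\<^bsup>N+1\<^esup> w\<^sub>j b\<close> along \<open>\<zeta>\<^sub>j\<close> integrates to zero against \<open>h\<close>. The sum over \<open>j\<close> of these
  identities trades a weight \<open>s\<^sup>N b\<close> for a weight \<open>s\<^bsup>N+1\<^esup> b'\<close> with \<open>b'\<close> one derivative less regular
  than \<open>b\<close> (lemma \<open>moment_reduction\<close>); \<open>2n\<close> such steps, from the weight \<open>1\<close>, give \<open>\<psi>\<close>.

  Both this reduction and the pointwise bound for \<open>\<bar>g(z)\<bar>\<close> rest on one integration by parts, lemma
  \<open>integral_holomorphic_dbar_eq_0\<close>, which in turn is the translation invariance of Lebesgue measure.
\<close>

section \<open>Calculus of \<open>C\<^sup>k\<close> functions\<close>

lemma compact_continuous_bound:
  fixes f :: "'a::topological_space \<Rightarrow> 'b::real_normed_vector"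
  assumes "compact K" "continuous_on K f"
  obtains M where "M \<ge> 0" "\<And>x. x \<in> K \<Longrightarrow> norm (f x) \<le> M"
proof -
  have "bounded (f ` K)" using assms compact_continuous_image compact_imp_bounded by blast
  then obtain M where "M > 0" "\<forall>y\<in>f ` K. norm y \<le> M" unfolding bounded_pos by blast
  then show thesis using that[of M] by auto
qed

lemma Ck_on_subset: "Ck_on k f S \<Longrightarrow> T \<subseteq> S \<Longrightarrow> Ck_on k f T"
  by (induction k arbitrary: f) (auto intro: continuous_on_subset)

lemma Ck_on_Suc_imp: "Ck_on (Suc k) f S \<Longrightarrow> Ck_on k f S"
proof (induction k arbitrary: f)
  case 0
  then have "f differentiable_on S" by (intro differentiable_at_imp_differentiable_on) simp
  then show ?case by (simp add: differentiable_imp_continuous_on)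
next
  case (Suc k)
  show ?case
    using Suc.prems Suc.IH by (subst Ck_on.simps) (auto simp del: Ck_on.simps(2) simp: Ck_on.simps(2)[of "Suc k"])
qed

lemma Ck_on_mono: "Ck_on k f S \<Longrightarrow> j \<le> k \<Longrightarrow> Ck_on j f S"
  by (induction k) (auto simp: le_Suc_eq simp del: Ck_on.simps dest: Ck_on_Suc_imp)

lemma Ck_on_continuous: "Ck_on k f S \<Longrightarrow> continuous_on S f"
  using Ck_on_mono[of k f S 0] by simp

lemma Ck_on_differentiable: "Ck_on (Suc k) f S \<Longrightarrow> x \<in> S \<Longrightarrow> f differentiable at x"
  by simp

lemma Ck_on_has_derivative:
  "Ck_on (Suc k) f S \<Longrightarrow> x \<in> S \<Longrightarrow> (f has_derivative frechet_derivative f (at x)) (at x)"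
  by (simp add: frechet_derivative_works)

lemma Ck_on_Un:
  assumes "open S" "open T" "Ck_on k f S" "Ck_on k f T" shows "Ck_on k f (S \<union> T)"
  using assms by (induction k arbitrary: f) (auto intro: continuous_on_open_Un)

lemma Ck_on_cong:
  assumes "open S" "\<And>x. x \<in> S \<Longrightarrow> f x = g x" "Ck_on k f S" shows "Ck_on k g S"
  using assms
proof (induction k arbitrary: f g)
  case 0 then show ?case by (auto cong: continuous_on_cong_simp simp: continuous_on_eq)
next
  case (Suc k)
  have d: "(g has_derivative frechet_derivative f (at x)) (at x)" if "x \<in> S" for x
    using has_derivative_transform_within_open[OF Ck_on_has_derivative[OF Suc.prems(3) that] Suc.prems(1) that]
      Suc.prems(2) by blast
  have e: "frechet_derivative f (at x) v = frechet_derivative g (at x) v" if "x \<in> S" for x v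
    using frechet_derivative_at[OF d[OF that]] by simp
  show ?case
    unfolding Ck_on.simps
  proof (intro conjI ballI allI)
    show "g differentiable at x" if "x \<in> S" for x using d[OF that] by (rule differentiableI)
    show "Ck_on k (\<lambda>x. frechet_derivative g (at x) v) S" for v
      using Suc.prems(3) by (intro Suc.IH[OF Suc.prems(1) e]) auto
  qed
qed

lemma Ck_on_SucI:
  assumes "open S" "\<And>x. x \<in> S \<Longrightarrow> (f has_derivative f' x) (at x)"
    and "\<And>v. Ck_on k (\<lambda>x. f' x v) S"
  shows "Ck_on (Suc k) f S"
  unfolding Ck_on.simps
proof (intro conjI ballI allI)
  show "f differentiable at x" if "x \<in> S" for x using assms(2)[OF that] by (rule differentiableI)
  show "Ck_on k (\<lambda>x. frechet_derivative f (at x) v) S" for v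
    by (rule Ck_on_cong[OF assms(1) _ assms(3)[of v]])
      (metis assms(2) frechet_derivative_at)
qed

lemma Ck_on_const: "Ck_on k (\<lambda>x. c) S"
  by (induction k arbitrary: c) (auto simp: frechet_derivative_const)

lemma Ck_on_Suc_deriv: "Ck_on (Suc k) f S \<Longrightarrow> Ck_on k (\<lambda>x. frechet_derivative f (at x) v) S"
  by simp

lemma Ck_on_bounded_linear:
  assumes "bounded_linear L" "open S" "Ck_on k f S" shows "Ck_on k (\<lambda>x. L (f x)) S"
  using assms(3)
proof (induction k arbitrary: f)
  case 0 then show ?case using assms(1) by (auto intro: bounded_linear.continuous_on)
next
  case (Suc k)
  show ?case
    by (rule Ck_on_SucI[OF assms(2), where f' = "\<lambda>x v. L (frechet_derivative f (at x) v)"])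
     (use Suc in \<open>auto intro!: bounded_linear.has_derivative[OF assms(1)] Ck_on_has_derivative simp del: Ck_on.simps simp: Ck_on_Suc_deriv\<close>)
qed

lemma Ck_on_linear:
  assumes "bounded_linear f" "open S" shows "Ck_on k f S"
proof (cases k)
  case 0 then show ?thesis using linear_continuous_on[OF assms(1)] by simp
next
  case (Suc j)
  show ?thesis unfolding Suc
    by (rule Ck_on_SucI[OF assms(2), where f' = "\<lambda>x v. f v"])
      (auto intro: bounded_linear_imp_has_derivative assms Ck_on_const)
qed

lemma Ck_on_add:
  assumes "open S" "Ck_on k f S" "Ck_on k g S" shows "Ck_on k (\<lambda>x. f x + g x) S"
  using assms(2,3)
proof (induction k arbitrary: f g)
  case 0 then show ?case by (auto intro: continuous_intros)
next
  case (Suc k)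
  show ?case
    by (rule Ck_on_SucI[OF assms(1) has_derivative_add[OF Ck_on_has_derivative[OF Suc.prems(1)]
      Ck_on_has_derivative[OF Suc.prems(2)]]]) (use Suc in auto)
qed

lemma Ck_on_mult:
  fixes f g :: "'a::real_normed_vector \<Rightarrow> 'b::real_normed_algebra"
  assumes "open S" "Ck_on k f S" "Ck_on k g S" shows "Ck_on k (\<lambda>x. f x * g x) S"
  using assms(2,3)
proof (induction k arbitrary: f g)
  case 0 then show ?case by (auto intro: continuous_intros)
next
  case (Suc k)
  show ?case
    by (rule Ck_on_SucI[OF assms(1) has_derivative_mult[OF Ck_on_has_derivative[OF Suc.prems(1)]
      Ck_on_has_derivative[OF Suc.prems(2)]]])
     (auto intro!: Ck_on_add[OF assms(1)] Suc.IH Ck_on_Suc_deriv Suc.prems Ck_on_Suc_imp[OF Suc.prems(1)]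
        Ck_on_Suc_imp[OF Suc.prems(2)] simp del: Ck_on.simps)
qed

lemma Ck_on_minus: "open S \<Longrightarrow> Ck_on k f S \<Longrightarrow> Ck_on k (\<lambda>x. - f x) S"
  by (rule Ck_on_bounded_linear[OF bounded_linear_minus[OF bounded_linear_ident]])

lemma Ck_on_diff:
  "open S \<Longrightarrow> Ck_on k f S \<Longrightarrow> Ck_on k g S \<Longrightarrow> Ck_on k (\<lambda>x. f x - g x) S"
  using Ck_on_add[of S k f "\<lambda>x. - g x"] Ck_on_minus[of S k g] by simp

lemma Ck_on_sum:
  assumes "open S" "\<And>i. i \<in> I \<Longrightarrow> Ck_on k (f i) S" shows "Ck_on k (\<lambda>x. \<Sum>i\<in>I. f i x) S"
  using assms(2) by (induction I rule: infinite_finite_induct) (auto intro: Ck_on_const Ck_on_add[OF assms(1)])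

lemma Ck_on_power:
  fixes f :: "'a::real_normed_vector \<Rightarrow> 'b::real_normed_algebra_1"
  assumes "open S" "Ck_on k f S" shows "Ck_on k (\<lambda>x. f x ^ m) S"
  by (induction m) (auto intro: Ck_on_const Ck_on_mult assms)

lemma Ck_on_inverse:
  fixes f :: "'a::real_normed_vector \<Rightarrow> 'b::real_normed_field"
  assumes "open S" "Ck_on k f S" "\<And>x. x \<in> S \<Longrightarrow> f x \<noteq> 0"
  shows "Ck_on k (\<lambda>x. inverse (f x)) S"
  using assms(2)
proof (induction k)
  case 0 then show ?case using assms(3) by (auto intro!: continuous_intros)
next
  case (Suc k)
  show ?case
    by (rule Ck_on_SucI[OF assms(1) Deriv.has_derivative_inverse[OF assms(3) Ck_on_has_derivative[OF Suc.prems]]])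
     (auto intro!: Ck_on_mult[OF assms(1)] Ck_on_minus[OF assms(1)] Suc.IH Ck_on_Suc_deriv[OF Suc.prems]
        Ck_on_Suc_imp[OF Suc.prems] simp del: Ck_on.simps)
qed

lemma has_real_derivative_max_power:
  "((\<lambda>t::real. max 0 t ^ Suc (Suc k)) has_real_derivative real (Suc (Suc k)) * max 0 t ^ Suc k) (at t)"
proof -
  consider "t < 0" | "t > 0" | "t = 0" by linarith
  then show ?thesis
  proof cases
    case 1
    have "((\<lambda>t::real. 0) has_real_derivative 0) (at t)" by simp
    then have "((\<lambda>t::real. max 0 t ^ Suc (Suc k)) has_real_derivative 0) (at t)"
      by (rule has_field_derivative_transform_within_open[where S = "{..<0}"]) (use 1 in auto)
    then show ?thesis using 1 by (simp add: max_def)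
  next
    case 2
    have "((\<lambda>t::real. t ^ Suc (Suc k)) has_real_derivative real (Suc (Suc k)) * t ^ Suc k) (at t)"
      using DERIV_pow[of "Suc (Suc k)" t] by simp
    then have "((\<lambda>t::real. max 0 t ^ Suc (Suc k)) has_real_derivative real (Suc (Suc k)) * t ^ Suc k) (at t)"
      by (rule has_field_derivative_transform_within_open[where S = "{0<..}"]) (use 2 in auto)
    then show ?thesis using 2 by (simp add: max_def)
  next
    case 3
    have "((\<lambda>h. max 0 h ^ Suc (Suc k) / h) \<longlongrightarrow> 0) (at (0::real))"
    proof (rule Lim_null_comparison)
      show "eventually (\<lambda>h::real. norm (max 0 h ^ Suc (Suc k) / h) \<le> \<bar>h\<bar> ^ Suc k) (at 0)"
      proof (rule always_eventually, rule allI)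
        fix h :: real
        show "norm (max 0 h ^ Suc (Suc k) / h) \<le> \<bar>h\<bar> ^ Suc k"
          using zero_le_power[OF abs_ge_zero[of h], of "Suc k"]
          by (cases "h \<le> 0") (simp_all add: max_absorb1 max_absorb2 del: abs_ge_zero)
      qed
      show "((\<lambda>h::real. \<bar>h\<bar> ^ Suc k) \<longlongrightarrow> 0) (at 0)"
        by (auto intro!: tendsto_eq_intros)
    qed
    then show ?thesis using 3 by (simp add: DERIV_def)
  qed
qed

text \<open>All cut-offs below are built from powers of positive parts: the power \<open>k + 1\<close> of a positive part costs
  nothing in regularity up to order \<open>k\<close>.\<close>

lemma Ck_on_max_power:
  assumes "open S" "Ck_on k f S" shows "Ck_on k (\<lambda>x. max 0 (f x) ^ Suc k :: real) S"
  using assms(2)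
proof (induction k)
  case 0 then show ?case by (auto intro!: continuous_intros)
next
  case (Suc k)
  show ?case
  proof (rule Ck_on_SucI[OF assms(1)])
    show "((\<lambda>x. max 0 (f x) ^ Suc (Suc k)) has_derivative
      (\<lambda>v. real (Suc (Suc k)) * max 0 (f x) ^ Suc k * frechet_derivative f (at x) v)) (at x)" if "x \<in> S" for x
      using has_derivative_compose[OF Ck_on_has_derivative[OF Suc.prems that]
          has_real_derivative_max_power[unfolded has_field_derivative_def]]
      by (simp add: o_def mult.commute)
    show "Ck_on k (\<lambda>x. real (Suc (Suc k)) * max 0 (f x) ^ Suc k * frechet_derivative f (at x) v) S" for v
      by (intro Ck_on_mult[OF assms(1)] Suc.IH Ck_on_Suc_deriv[OF Suc.prems] Ck_on_Suc_imp[OF Suc.prems] Ck_on_const)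
  qed
qed

section \<open>Integration by parts against holomorphic functions\<close>

text \<open>The integrals of the difference quotients of \<open>G\<close> in the direction \<open>v\<close> vanish by translation
  invariance. The bound on \<open>D\<close> dominates the quotients, so the integral of their limit vanishes too;
  continuity of \<open>D\<close> is not available for the functions this is applied to.\<close>

lemma integral_directional_derivative_eq_0:
  fixes G :: "'a::euclidean_space \<Rightarrow> complex" and v :: 'a
  assumes der: "\<And>x. ((\<lambda>t. G (x + t *\<^sub>R v)) has_vector_derivative D x) (at 0)"
    and bd: "\<And>x. norm (D x) \<le> B"
    and K: "bounded K" "\<And>x. x \<notin> K \<Longrightarrow> G x = 0"
    and cont: "continuous_on UNIV G"
  shows "D \<in> borel_measurable borel" "integrable lborel D" "(\<integral>x. D x \<partial>lborel) = 0"
proof -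
  define q where "q k x = real (Suc k) *\<^sub>R (G (x + (1 / real (Suc k)) *\<^sub>R v) - G x)" for k x
  have [measurable]: "G \<in> borel_measurable borel"
    using cont by (rule borel_measurable_continuous_onI)
  have qm [measurable]: "q k \<in> borel_measurable borel" for k
    unfolding q_def by measurable
  have B: "B \<ge> 0" using bd[of 0] norm_ge_zero order_trans by blast
  have derv: "((\<lambda>t. G (x + t *\<^sub>R v)) has_vector_derivative D (x + t *\<^sub>R v)) (at t)" for x t
  proof -
    have "((\<lambda>s. G (x + t *\<^sub>R v + s *\<^sub>R v)) \<circ> (\<lambda>s. s - t) has_vector_derivative (1 *\<^sub>R D (x + t *\<^sub>R v))) (at t)"
      by (rule vector_diff_chain_at) (auto intro!: derivative_eq_intros der)
    then show ?thesis by (simp add: o_def algebra_simps)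
  qed
  have lip: "norm (G (x + t *\<^sub>R v) - G x) \<le> B * \<bar>t\<bar>" for x t
  proof -
    have "norm (G (x + t *\<^sub>R v) - G (x + 0 *\<^sub>R v)) \<le> B * norm (t - 0)"
    proof (rule differentiable_bound[where S = UNIV])
      show "((\<lambda>t. G (x + t *\<^sub>R v)) has_derivative (\<lambda>h. h *\<^sub>R D (x + s *\<^sub>R v))) (at s)" for s
        using derv[of x s] by (simp add: has_vector_derivative_def)
      show "onorm (\<lambda>h. h *\<^sub>R D (x + s *\<^sub>R v)) \<le> B" for s
        using bd[of "x + s *\<^sub>R v"] by (intro onorm_le) (metis abs_ge_zero mult.commute mult_right_mono norm_scaleR real_norm_def)
    qed auto
    then show ?thesis by simp
  qed
  obtain R where R: "\<And>x. x \<in> K \<Longrightarrow> norm x \<le> R"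
    using K(1) bounded_iff by blast
  \<comment> \<open>All translates involved live in one ball, on which a constant dominates.\<close>
  have qb: "norm (q k x) \<le> indicator (cball 0 (R + norm v)) x *\<^sub>R B" for k x
  proof (cases "x \<in> cball 0 (R + norm v)")
    case True
    have "norm (q k x) = real (Suc k) * norm (G (x + (1 / real (Suc k)) *\<^sub>R v) - G x)"
      unfolding q_def by simp
    also have "\<dots> \<le> real (Suc k) * (B * \<bar>1 / real (Suc k)\<bar>)"
      by (intro mult_left_mono lip) auto
    finally show ?thesis using True by simp
  next
    case False
    then have n: "norm x > R + norm v" by simp
    have 1: "x \<notin> K" using n R[of x] norm_ge_zero[of v] by linarith
    have "norm x \<le> norm (x + (1 / real (Suc k)) *\<^sub>R v) + norm ((1 / real (Suc k)) *\<^sub>R v)"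
      using norm_triangle_ineq4[of "x + (1 / real (Suc k)) *\<^sub>R v" "(1 / real (Suc k)) *\<^sub>R v"] by simp
    moreover have "norm ((1 / real (Suc k)) *\<^sub>R v) \<le> norm v"
      by (simp add: divide_le_eq mult_le_cancel_left1)
    ultimately have "x + (1 / real (Suc k)) *\<^sub>R v \<notin> K"
      using n R[of "x + (1 / real (Suc k)) *\<^sub>R v"] by linarith
    then show ?thesis using 1 K(2) False by (simp add: q_def)
  qed
  have lim: "(\<lambda>k. q k x) \<longlonglongrightarrow> D x" for x
  proof -
    have "((\<lambda>h. norm (G (x + h *\<^sub>R v) - G x - h *\<^sub>R D x) / norm h) \<longlongrightarrow> 0) (at 0)"
      using der[of x] unfolding has_vector_derivative_def has_derivative_at by simp
    moreover have "filterlim (\<lambda>k. 1 / real (Suc k)) (at 0) sequentially"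
      unfolding filterlim_at using LIMSEQ_Suc[OF lim_1_over_n[where 'a = real]] by (simp del: of_nat_Suc)
    ultimately have "((\<lambda>k. norm (G (x + (1 / real (Suc k)) *\<^sub>R v) - G x - (1 / real (Suc k)) *\<^sub>R D x) / norm (1 / real (Suc k))) \<longlongrightarrow> 0) sequentially"
      by (rule filterlim_compose)
    moreover have "norm (G (x + (1 / real (Suc k)) *\<^sub>R v) - G x - (1 / real (Suc k)) *\<^sub>R D x) / norm (1 / real (Suc k)) = norm (q k x - D x)" for k
    proof -
      have "q k x - D x = real (Suc k) *\<^sub>R (G (x + (1 / real (Suc k)) *\<^sub>R v) - G x - (1 / real (Suc k)) *\<^sub>R D x)"
        by (simp add: q_def scaleR_diff_right)
      then show ?thesis by simp
    qed
    ultimately have "(\<lambda>k. norm (q k x - D x)) \<longlonglongrightarrow> 0" by simp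
    then show ?thesis using LIM_zero_cancel tendsto_norm_zero_iff by blast
  qed
  show Dm: "D \<in> borel_measurable borel"
    by (rule borel_measurable_LIMSEQ_metric[OF qm lim])
  have w: "integrable lborel (\<lambda>x. indicator (cball 0 (R + norm v)) x *\<^sub>R B)"
    by (intro integrable_scaleR_left integrable_real_indicator) (simp, rule emeasure_bounded_finite, simp)
  show "integrable lborel D"
    by (rule integrable_dominated_convergence[where s = q and w = "\<lambda>x. indicator (cball 0 (R + norm v)) x *\<^sub>R B"])
      (use Dm qm w lim qb in auto)
  have "(\<lambda>k. \<integral>x. q k x \<partial>lborel) \<longlonglongrightarrow> (\<integral>x. D x \<partial>lborel)"
    by (rule integral_dominated_convergence[where w = "\<lambda>x. indicator (cball 0 (R + norm v)) x *\<^sub>R B"])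
      (use Dm qm w lim qb in auto)
  moreover have "(\<integral>x. q k x \<partial>lborel) = 0" for k
  proof -
    obtain C where C: "\<And>x. x \<in> cball 0 R \<Longrightarrow> norm (G x) \<le> C"
      using compact_continuous_bound[OF compact_cball continuous_on_subset[OF cont subset_UNIV]] by metis
    have gi: "integrable lborel G"
    proof (rule Bochner_Integration.integrable_bound)
      show "integrable lborel (\<lambda>x. indicator (cball 0 R) x *\<^sub>R C)"
        by (intro integrable_scaleR_left integrable_real_indicator) (simp, rule emeasure_bounded_finite, simp)
      have "norm (G x) \<le> norm (indicator (cball 0 R) x *\<^sub>R C)" for x
      proof (cases "x \<in> cball 0 R")
        case True then show ?thesis using C[OF True] by simp
      next
        case False then have "x \<notin> K" using R by auto
        then show ?thesis using K(2) by simp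
      qed
      then show "AE x in lborel. norm (G x) \<le> norm (indicator (cball 0 R) x *\<^sub>R C)" by simp
    qed simp
    define c where "c = (1 / real (Suc k)) *\<^sub>R v"
    have d: "distr lborel borel (\<lambda>x. x + c) = lborel"
      using lborel_distr_plus[of c] by (simp add: add.commute[of _ c, abs_def])
    have "integrable (distr lborel borel (\<lambda>x. x + c)) G" using gi by (simp add: d)
    then have i2: "integrable lborel (\<lambda>x. G (x + c))"
      by (subst (asm) integrable_distr_eq) auto
    have "(\<integral>x. G (x + c) \<partial>lborel) = (\<integral>x. G x \<partial>distr lborel borel (\<lambda>x. x + c))"
      by (subst integral_distr) auto
    then have "(\<integral>x. G (x + c) \<partial>lborel) = (\<integral>x. G x \<partial>lborel)" by (simp add: d)
    then show ?thesis using gi i2 unfolding q_def c_def[symmetric] by simp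
  qed
  ultimately show "(\<integral>x. D x \<partial>lborel) = 0"
    by (simp add: LIMSEQ_const_iff)
qed

text \<open>Twice the derivative along the conjugate of the \<open>j\<close>-th coordinate.\<close>

definition dbar :: "'n \<Rightarrow> (complex ^ 'n \<Rightarrow> complex) \<Rightarrow> complex ^ 'n \<Rightarrow> complex" where
  "dbar j f z = frechet_derivative f (at z) (axis j 1) + \<i> * frechet_derivative f (at z) (axis j \<i>)"

lemma norm_axis: "norm (axis j c) = norm c"
  by (simp add: norm_vec_def L2_set_def axis_def if_distrib[where f = "\<lambda>x. (norm x)\<^sup>2"] cong: if_cong)

lemma axis_i_eq: "axis j \<i> = \<i> *s axis j 1"
  by (simp add: vec_eq_iff axis_def)

lemma holomorphic_in_continuous_on: "holomorphic_in h \<Omega> \<Longrightarrow> continuous_on \<Omega> h"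
  unfolding holomorphic_in_def
  by (intro continuous_at_imp_continuous_on ballI) (blast intro: has_derivative_continuous)

lemma holomorphic_in_derivative:
  assumes "holomorphic_in h \<Omega>" "z \<in> \<Omega>"
  shows "(h has_derivative frechet_derivative h (at z)) (at z)"
    and "frechet_derivative h (at z) (c *s v) = c * frechet_derivative h (at z) v"
proof -
  obtain L where L: "(h has_derivative L) (at z)" "\<And>c v. L (c *s v) = c * L v"
    using assms unfolding holomorphic_in_def by blast
  then have "L = frechet_derivative h (at z)" by (intro frechet_derivative_at)
  then show "(h has_derivative frechet_derivative h (at z)) (at z)"
    and "frechet_derivative h (at z) (c *s v) = c * frechet_derivative h (at z) v"
    using L by auto
qed

lemma dbar_holomorphic: "holomorphic_in h \<Omega> \<Longrightarrow> z \<in> \<Omega> \<Longrightarrow> dbar j h z = 0"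
  unfolding dbar_def axis_i_eq by (simp add: holomorphic_in_derivative(2))

lemma dbar_eqI:
  "(f has_derivative f') (at z) \<Longrightarrow> dbar j f z = f' (axis j 1) + \<i> * f' (axis j \<i>)"
  unfolding dbar_def using frechet_derivative_at by metis

text \<open>The Cauchy estimate on the disc of radius \<open>d\<close> about \<open>z\<close> in the \<open>j\<close>-th complex coordinate line.\<close>

lemma norm_derivative_holomorphic_le:
  fixes h :: "complex ^ 'n \<Rightarrow> complex"
  assumes "holomorphic_in h \<Omega>" "d > 0" "cball z d \<subseteq> \<Omega>" "\<And>x. x \<in> cball z d \<Longrightarrow> norm (h x) \<le> M"
  shows "norm (frechet_derivative h (at z) (axis j 1)) \<le> M / d"
proof -
  let ?e = "axis j 1 :: complex ^ 'n"
  define \<phi> where "\<phi> \<zeta> = h (z + \<zeta> *s ?e)" for \<zeta>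
  have n: "norm (\<zeta> *s ?e) = norm \<zeta>" for \<zeta>
  proof -
    have "\<zeta> *s ?e = axis j \<zeta>" by (simp add: vec_eq_iff axis_def)
    then show ?thesis by (simp add: norm_axis)
  qed
  have l: "bounded_linear (\<lambda>\<zeta>. \<zeta> *s ?e)"
    by (rule bounded_linear_intro[where K = 1])
      (auto simp: n vec_eq_iff algebra_simps)
  have der: "(\<phi> has_field_derivative frechet_derivative h (at (z + \<zeta> *s ?e)) ?e) (at \<zeta>)" if "norm \<zeta> \<le> d" for \<zeta>
  proof -
    have mem: "z + \<zeta> *s ?e \<in> \<Omega>" using that assms(3) by (auto simp: dist_norm n)
    have "((\<lambda>\<zeta>. z + \<zeta> *s ?e) has_derivative (\<lambda>\<zeta>. \<zeta> *s ?e)) (at \<zeta>)"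
      using has_derivative_add[OF has_derivative_const bounded_linear_imp_has_derivative[OF l]] by simp
    note D = has_derivative_compose[OF this holomorphic_in_derivative(1)[OF assms(1) mem]]
    show ?thesis unfolding has_field_derivative_def \<phi>_def
      by (rule has_derivative_eq_rhs[OF D]) (simp add: fun_eq_iff holomorphic_in_derivative(2)[OF assms(1) mem])
  qed
  have hol: "\<phi> holomorphic_on cball 0 d"
    unfolding holomorphic_on_def field_differentiable_def
    using der by (metis dist_0_norm has_field_derivative_at_within mem_cball)
  have "norm ((deriv ^^ 1) \<phi> 0) \<le> fact 1 * M / d ^ 1"
  proof (rule Cauchy_inequality)
    show "norm (\<phi> x) \<le> M" if "norm (0 - x) = d" for x
      unfolding \<phi>_def using that by (intro assms(4)) (auto simp: dist_norm n)
  qed (use hol assms(2) in \<open>auto intro: holomorphic_on_subset holomorphic_on_imp_continuous_on\<close>)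
  moreover have "deriv \<phi> 0 = frechet_derivative h (at z) ?e"
    using DERIV_imp_deriv[OF der[of 0]] assms(2) by simp
  ultimately show ?thesis by simp
qed

text \<open>The product of \<open>h\<close> and \<open>F\<close>, extended by zero, is differentiable with compact support, and its
  \<open>dbar j\<close> is \<open>h * dbar j F\<close> as \<open>h\<close> satisfies the Cauchy-Riemann equations. Holomorphy here provides
  only the existence of the derivative of \<open>h\<close>; its boundedness near the support of \<open>F\<close> comes from the
  Cauchy estimate.\<close>

lemma integral_holomorphic_dbar_eq_0:
  fixes h F :: "complex ^ 'n \<Rightarrow> complex"
  assumes \<Omega>: "open \<Omega>" and h: "holomorphic_in h \<Omega>" and F: "Ck_on 1 F \<Omega>"
    and K: "compact K" "K \<subseteq> \<Omega>" "\<And>z. z \<in> \<Omega> - K \<Longrightarrow> F z = 0"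
  shows "(LINT z|lebesgue_on \<Omega>. h z * dbar j F z) = 0"
proof -
  define G where "G z = (if z \<in> \<Omega> then h z * F z else 0)" for z
  define G' where "G' z v = (if z \<in> \<Omega> then h z * frechet_derivative F (at z) v + frechet_derivative h (at z) v * F z else 0)" for z v
  have G0: "G z = 0" if "z \<notin> K" for z using that K by (auto simp: G_def)
  have G: "(G has_derivative G' z) (at z)" for z
  proof (cases "z \<in> \<Omega>")
    case True
    have "((\<lambda>z. h z * F z) has_derivative (\<lambda>v. h z * frechet_derivative F (at z) v + frechet_derivative h (at z) v * F z)) (at z)"
      using F True by (intro has_derivative_mult holomorphic_in_derivative[OF h] Ck_on_has_derivative[of 0]) auto
    then have "(G has_derivative (\<lambda>v. h z * frechet_derivative F (at z) v + frechet_derivative h (at z) v * F z)) (at z)"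
      by (rule has_derivative_transform_within_open[OF _ \<Omega> True]) (simp add: G_def)
    then show ?thesis using True by (simp add: G'_def[abs_def])
  next
    case False
    have "(G has_derivative (\<lambda>v. 0)) (at z)"
      by (rule has_derivative_transform_within_open[where f = "\<lambda>x. 0" and s = "- K"])
        (use K False G0 in \<open>auto simp: compact_imp_closed open_Compl\<close>)
    then show ?thesis using False by (simp add: G'_def[abs_def])
  qed
  have G'0: "G' z v = 0" if "z \<notin> K" for z v
  proof -
    have "(G has_derivative (\<lambda>v. 0)) (at z)"
      by (rule has_derivative_transform_within_open[where f = "\<lambda>x. 0" and s = "- K"])
        (use K that G0 in \<open>auto simp: compact_imp_closed open_Compl\<close>)
    then show ?thesis using has_derivative_unique[OF G] by metis
  qed
  have contG: "continuous_on UNIV G"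
    using has_derivative_continuous[OF G] by (simp add: continuous_at_imp_continuous_on)
  have bdd: "\<exists>B. \<forall>z. norm (G' z (axis j c)) \<le> B" if c: "c = 1 \<or> c = \<i>" for c
  proof -
    obtain d where d: "d > 0" "(\<Union>x\<in>K. cball x d) \<subseteq> \<Omega>"
      using compact_subset_open_imp_cball_epsilon_subset[OF K(1) \<Omega> K(2)] by auto
    have cK: "compact (\<Union>x\<in>K. cball x d)"
      by (rule compact_minkowski_sum_cball[OF K(1)])
    obtain M where M: "\<And>x. x \<in> (\<Union>x\<in>K. cball x d) \<Longrightarrow> norm (h x) \<le> M"
      using compact_continuous_bound[OF cK continuous_on_subset[OF holomorphic_in_continuous_on[OF h] d(2)]] by blast
    obtain M1 where M1: "\<And>x. x \<in> K \<Longrightarrow> norm (F x) \<le> M1"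
      using compact_continuous_bound[OF K(1) continuous_on_subset[OF Ck_on_continuous[OF F] K(2)]] by blast
    have "continuous_on \<Omega> (\<lambda>x. frechet_derivative F (at x) (axis j c))"
      using F by simp
    then obtain M2 where M2: "\<And>x. x \<in> K \<Longrightarrow> norm (frechet_derivative F (at x) (axis j c)) \<le> M2"
      using compact_continuous_bound[OF K(1) continuous_on_subset[OF _ K(2)]] by blast
    \<comment> \<open>The three constants bound \<open>h\<close> near \<open>K\<close>, the derivative of \<open>F\<close> and \<open>F\<close> itself.\<close>
    have "norm (G' z (axis j c)) \<le> M * M2 + M / d * M1" if z: "z \<in> K" for z
    proof -
      have zM: "norm (h z) \<le> M" using M z d(1) by force
      have "norm (frechet_derivative h (at z) (axis j 1)) \<le> M / d"
        by (rule norm_derivative_holomorphic_le[OF h d(1)]) (use z d M in blast)+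
      moreover have "norm (frechet_derivative h (at z) (axis j c)) = norm (frechet_derivative h (at z) (axis j 1))"
        using c holomorphic_in_derivative(2)[OF h, of z] z K(2) by (auto simp: axis_i_eq norm_mult)
      ultimately have "norm (frechet_derivative h (at z) (axis j c) * F z) \<le> M / d * M1"
        unfolding norm_mult using M1[OF z] by (intro mult_mono) (auto intro: order_trans[OF norm_ge_zero])
      moreover have "norm (h z * frechet_derivative F (at z) (axis j c)) \<le> M * M2"
        unfolding norm_mult using M2[OF z] zM by (intro mult_mono) (auto intro: order_trans[OF norm_ge_zero])
      ultimately show ?thesis using z K(2) by (auto simp: G'_def intro: norm_triangle_le)
    qed
    then have "norm (G' z (axis j c)) \<le> max 0 (M * M2 + M / d * M1)" for z
      by (cases "z \<in> K") (auto simp: G'0 le_max_iff_disj)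
    then show ?thesis by blast
  qed
  have lin: "((\<lambda>t. G (x + t *\<^sub>R v)) has_vector_derivative G' x v) (at 0)" for x v
  proof -
    have "((\<lambda>t. x + t *\<^sub>R v) has_derivative (\<lambda>t. t *\<^sub>R v)) (at 0)"
      by (auto intro!: derivative_eq_intros)
    moreover have "(G has_derivative G' x) (at (x + 0 *\<^sub>R v))" using G[of x] by simp
    ultimately have "((\<lambda>t. G (x + t *\<^sub>R v)) has_derivative (\<lambda>t. G' x (t *\<^sub>R v))) (at 0)"
      by (rule has_derivative_compose)
    then show ?thesis unfolding has_vector_derivative_def
      using linear_cmul[OF has_derivative_linear[OF G]] by simp
  qed
  have int: "(\<lambda>x. G' x (axis j c)) \<in> borel_measurable borel \<and> integrable lborel (\<lambda>x. G' x (axis j c)) \<and> (\<integral>x. G' x (axis j c) \<partial>lborel) = 0"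
    if c: "c = 1 \<or> c = \<i>" for c
  proof -
    obtain B where B: "\<And>z. norm (G' z (axis j c)) \<le> B" using bdd[OF c] by blast
    show ?thesis
      using integral_directional_derivative_eq_0[OF lin B compact_imp_bounded[OF K(1)] G0 contG] by blast
  qed
  note int1 = int[of 1, simplified] and inti = int[of \<i>, simplified]
  have [measurable]: "(\<lambda>x. G' x (axis j 1)) \<in> borel_measurable borel" "(\<lambda>x. G' x (axis j \<i>)) \<in> borel_measurable borel"
    using int1 inti by blast+
  let ?I = "\<lambda>x. G' x (axis j 1) + \<i> * G' x (axis j \<i>)"
  have "(LINT z|lebesgue_on \<Omega>. h z * dbar j F z) = (\<integral>z. indicator \<Omega> z *\<^sub>R (h z * dbar j F z) \<partial>lebesgue)"
    by (rule integral_restrict_space) (use \<Omega> in auto)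
  also have "\<dots> = (\<integral>z. ?I z \<partial>lebesgue)"
  proof (rule Bochner_Integration.integral_cong[OF refl])
    fix z show "indicator \<Omega> z *\<^sub>R (h z * dbar j F z) = ?I z"
    proof (cases "z \<in> \<Omega>")
      case True
      have "?I z = h z * dbar j F z + F z * dbar j h z"
        using True by (simp add: G'_def dbar_def algebra_simps)
      then show ?thesis using True dbar_holomorphic[OF h True] by simp
    qed (simp add: G'_def)
  qed
  also have "\<dots> = (\<integral>z. ?I z \<partial>lborel)"
    by (rule integral_completion) measurable
  also have "\<dots> = (\<integral>z. G' z (axis j 1) \<partial>lborel) + \<i> * (\<integral>z. G' z (axis j \<i>) \<partial>lborel)"
    using int1 inti by (subst Bochner_Integration.integral_add) auto
  also have "\<dots> = 0" using int1 inti by simp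
  finally show ?thesis .
qed

lemma dbar_cong:
  assumes "open S" "z \<in> S" "\<And>x. x \<in> S \<Longrightarrow> f x = g x" "f differentiable at z"
  shows "dbar j f z = dbar j g z"
proof -
  have "(f has_derivative frechet_derivative f (at z)) (at z)"
    using assms(4) by (simp add: frechet_derivative_works)
  then have "(g has_derivative frechet_derivative f (at z)) (at z)"
    by (rule has_derivative_transform_within_open[OF _ assms(1,2)]) (use assms(3) in auto)
  then have "frechet_derivative f (at z) = frechet_derivative g (at z)"
    by (rule frechet_derivative_at)
  then show ?thesis unfolding dbar_def by simp
qed

lemma dbar_mult:
  assumes "f differentiable at z" "g differentiable at z"
  shows "dbar j (\<lambda>x. f x * g x) z = f z * dbar j g z + dbar j f z * g z"
  by (subst dbar_eqI[OF has_derivative_mult[OF assms[unfolded frechet_derivative_works]]])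
    (simp add: dbar_def algebra_simps)

lemma Ck_on_dbar:
  assumes "open S" "Ck_on (Suc k) f S" shows "Ck_on k (dbar j f) S"
  unfolding dbar_def[abs_def]
  by (intro Ck_on_add Ck_on_mult Ck_on_const Ck_on_Suc_deriv assms)

lemma dbar_of_real_compose:
  fixes f :: "complex ^ 'n \<Rightarrow> real"
  assumes "(\<phi> has_real_derivative d) (at (f z))" "f differentiable at z"
  shows "dbar j (\<lambda>x. of_real (\<phi> (f x))) z = of_real d * dbar j (\<lambda>x. of_real (f x)) z"
proof -
  have f: "(f has_derivative frechet_derivative f (at z)) (at z)"
    using assms(2) by (simp add: frechet_derivative_works)
  have 1: "((\<lambda>x. complex_of_real (f x)) has_derivative (\<lambda>v. of_real (frechet_derivative f (at z) v))) (at z)"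
    by (rule has_derivative_of_real[OF f])
  have 2: "((\<lambda>x. complex_of_real (\<phi> (f x))) has_derivative (\<lambda>v. of_real (d * frechet_derivative f (at z) v))) (at z)"
    by (rule has_derivative_of_real[OF has_derivative_compose[OF f assms(1)[unfolded has_field_derivative_def]]])
  show ?thesis unfolding dbar_eqI[OF 1] dbar_eqI[OF 2] by (simp add: algebra_simps)
qed

section \<open>A pointwise bound for integrable holomorphic functions\<close>

lemma borel_measurable_lebesgue_on_continuous:
  "open S \<Longrightarrow> continuous_on S f \<Longrightarrow> f \<in> borel_measurable (lebesgue_on S)"
  by (rule continuous_imp_measurable_on_sets_lebesgue) auto

lemma integrable_indicator_lebesgue_on:
  assumes "open S" "K \<in> lmeasurable" "K \<subseteq> S"
  shows "integrable (lebesgue_on S) (indicator K :: _ \<Rightarrow> real)"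
    and "(LINT x|lebesgue_on S. indicator K x) = measure lebesgue K"
proof -
  have S: "S \<in> sets lebesgue" using assms by auto
  have K: "K \<in> sets (lebesgue_on S)" using assms S by (auto simp: sets_restrict_space_iff)
  have e: "emeasure (lebesgue_on S) K = emeasure lebesgue K"
    using assms S by (intro emeasure_restrict_space) auto
  show "integrable (lebesgue_on S) (indicator K :: _ \<Rightarrow> real)"
    using assms(2) K by (intro integrable_real_indicator) (auto simp: e fmeasurable_def)
  show "(LINT x|lebesgue_on S. indicator K x) = measure lebesgue K"
    using K assms(3) by (simp add: measure_def e Int_absorb2)
qed

lemma integrable_compact_support:
  fixes f :: "'a::euclidean_space \<Rightarrow> 'b::{banach,second_countable_topology}"
  assumes "open S" "continuous_on S f" "compact K" "K \<subseteq> S" "\<And>x. x \<in> S - K \<Longrightarrow> f x = 0"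
  shows "integrable (lebesgue_on S) f"
proof -
  obtain M where M: "M \<ge> 0" "\<And>x. x \<in> K \<Longrightarrow> norm (f x) \<le> M"
    using compact_continuous_bound[OF assms(3) continuous_on_subset[OF assms(2,4)]] by metis
  show ?thesis
  proof (rule Bochner_Integration.integrable_bound)
    show "integrable (lebesgue_on S) (\<lambda>x. M * indicator K x)"
      by (intro integrable_mult_right integrable_indicator_lebesgue_on assms lmeasurable_compact)
    show "AE x in lebesgue_on S. norm (f x) \<le> norm (M * indicator K x)"
    proof (rule AE_I2)
      fix x assume "x \<in> space (lebesgue_on S)"
      then show "norm (f x) \<le> norm (M * indicator K x)"
        using M assms(5)[of x] by (cases "x \<in> K") auto
    qed
  qed (rule borel_measurable_lebesgue_on_continuous[OF assms(1,2)])
qed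

text \<open>
  The pointwise bound comes from a regularised Bochner-Martinelli kernel. With \<open>q = \<bar>w - z\<bar>\<^sup>2\<close>, the
  vector field whose \<open>j\<close>-th component is the conjugate of \<open>w\<^sub>j - z\<^sub>j\<close> times \<open>bump n R q / (q + a)\<^sup>n\<close> has
  \<open>dbar\<close>-divergence \<open>2 (peak - tail)\<close>, where, as \<open>a\<close> tends to zero, \<open>peak\<close> concentrates at \<open>z\<close> with mass
  bounded below, while \<open>tail\<close> stays bounded. The \<open>n\<close>-th power of \<open>t / R\<close> in the cut-off cancels the
  singularity of \<open>tail\<close> at zero.
\<close>

definition bump :: "nat \<Rightarrow> real \<Rightarrow> real \<Rightarrow> real" where
  "bump n R t = max 0 (1 - (t / R) ^ n) ^ 2"

definition peak :: "nat \<Rightarrow> real \<Rightarrow> real \<Rightarrow> real \<Rightarrow> real" where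
  "peak n R a t = n * a * bump n R t / (t + a) ^ Suc n"

definition tail :: "nat \<Rightarrow> real \<Rightarrow> real \<Rightarrow> real \<Rightarrow> real" where
  "tail n R a t = 2 * n * max 0 (1 - (t / R) ^ n) * (t / R) ^ n / (t + a) ^ n"

lemma bump_quotient_derivative:
  assumes "t \<ge> 0" "a > 0" "R > 0" "n > 0"
  obtains d where "((\<lambda>t. bump n R t / (t + a) ^ n) has_real_derivative d) (at t)"
    "t * d + n * (bump n R t / (t + a) ^ n) = peak n R a t - tail n R a t"
proof -
  obtain m where m: "n = Suc m" using assms(4) gr0_implies_Suc by blast
  define u where "u = max 0 (1 - (t / R) ^ n)"
  have ta: "t + a > 0" using assms by simp
  have b: "(bump n R has_real_derivative (2 * u) * (- (n * (t / R) ^ m / R))) (at t)"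
  proof -
    have 1: "((\<lambda>t. 1 - (t / R) ^ n) has_real_derivative (- (n * (t / R) ^ m / R))) (at t)"
    proof -
      have "((\<lambda>t. t / R) has_real_derivative 1 / R) (at t)"
        using DERIV_cdivide[OF DERIV_ident, of R] by simp
      from DERIV_diff[OF DERIV_const[of 1] DERIV_power[OF this, of n]] show ?thesis
        by (simp add: m algebra_simps)
    qed
    have "((\<lambda>t. max 0 t ^ 2) has_real_derivative 2 * u) (at (1 - (t / R) ^ n))"
      using has_real_derivative_max_power[of 0 "1 - (t / R) ^ n"] by (simp add: u_def numeral_2_eq_2)
    from DERIV_chain2[OF this 1] show ?thesis by (simp add: bump_def[abs_def])
  qed
  have c: "((\<lambda>t. (t + a) ^ n) has_real_derivative n * (t + a) ^ m) (at t)"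
  proof -
    have "((\<lambda>t. t + a) has_real_derivative 1) (at t)" by (auto intro!: derivative_eq_intros)
    from DERIV_power[OF this, of n] show ?thesis by (simp add: m)
  qed
  let ?d = "((2 * u) * (- (n * (t / R) ^ m / R)) * (t + a) ^ n - bump n R t * (n * (t + a) ^ m)) / ((t + a) ^ n * (t + a) ^ n)"
  have "((\<lambda>t. bump n R t / (t + a) ^ n) has_real_derivative ?d) (at t)"
    by (rule DERIV_divide[OF b c]) (use ta in auto)
  moreover have "t * ?d + n * (bump n R t / (t + a) ^ n) = peak n R a t - tail n R a t"
  proof -
    have e1: "t * ?d = - (2 * real n * u * (t / R) ^ n / (t + a) ^ n) - t * n * bump n R t / (t + a) ^ Suc n"
    proof -
      define S where "S = t + a"
      have "S > 0" using ta by (simp add: S_def)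
      then show ?thesis unfolding S_def[symmetric] using assms(3) by (simp add: m divide_simps power_divide) (simp add: algebra_simps)
    qed
    have e2: "n * (bump n R t / (t + a) ^ n) = n * bump n R t * (t + a) / (t + a) ^ Suc n"
      using ta by simp
    have "n * bump n R t * (t + a) / P = t * n * bump n R t / P + n * a * bump n R t / P" if "P = (t + a) ^ Suc n" for P
      by (simp add: add_divide_distrib[symmetric] algebra_simps)
    note e3 = this[OF refl]
    show ?thesis
      unfolding peak_def tail_def u_def[symmetric] e1 e2 e3 by simp
  qed
  ultimately show thesis using that by blast
qed

lemma power2_norm_vec: "(norm (w :: complex ^ 'n))\<^sup>2 = (\<Sum>j\<in>UNIV. (norm (w $ j))\<^sup>2)"
  by (simp add: norm_vec_def L2_set_def sum_nonneg)

lemma has_derivative_norm_sq: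
  "((\<lambda>w::'a::real_inner. (norm (w - z))\<^sup>2) has_derivative (\<lambda>v. 2 * ((w - z) \<bullet> v))) (at w)"
  unfolding power2_norm_eq_inner
  by (auto intro!: derivative_eq_intros simp: inner_commute)

text \<open>The divergence of the regularised kernel is orthogonal to holomorphic functions.\<close>

lemma integral_holomorphic_peak_eq_tail:
  fixes h :: "complex ^ 'n \<Rightarrow> complex"
  assumes \<Omega>: "open \<Omega>" and h: "holomorphic_in h \<Omega>" and r: "r > 0" and a: "a > 0" and K: "cball z r \<subseteq> \<Omega>"
  defines "q \<equiv> \<lambda>w. (norm (w - z))\<^sup>2"
  shows "(LINT w|lebesgue_on \<Omega>. h w * of_real (peak CARD('n) (r\<^sup>2) a (q w))) =
         (LINT w|lebesgue_on \<Omega>. h w * of_real (tail CARD('n) (r\<^sup>2) a (q w)))" (is "?A = ?B")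
    and "integrable (lebesgue_on \<Omega>) (\<lambda>w. peak CARD('n) (r\<^sup>2) a (q w))"
    and "integrable (lebesgue_on \<Omega>) (\<lambda>w. h w * of_real (peak CARD('n) (r\<^sup>2) a (q w)))"
    and "integrable (lebesgue_on \<Omega>) (\<lambda>w. h w * of_real (tail CARD('n) (r\<^sup>2) a (q w)))"
proof -
  let ?n = "CARD('n)"
  let ?R = "r\<^sup>2"
  define \<Phi> where "\<Phi> t = bump ?n ?R t / (t + a) ^ ?n" for t
  define F where "F j w = cnj (w $ j - z $ j) * of_real (\<Phi> (q w))" for j w
  have q0: "q w \<ge> 0" for w by (simp add: q_def)
  have qK: "(q w / ?R) ^ ?n \<ge> 1" if "w \<notin> cball z r" for w
  proof -
    have "r \<le> norm (w - z)" using that by (simp add: dist_norm norm_minus_commute)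
    then have "?R \<le> q w" unfolding q_def using r by (intro power_mono) auto
    then show ?thesis using r by (intro one_le_power) (simp add: divide_simps)
  qed
  have Ckq: "Ck_on 2 q \<Omega>"
  proof -
    have "Ck_on 2 (\<lambda>w. \<Sum>j\<in>UNIV. (Re (w $ j) - Re (z $ j))\<^sup>2 + (Im (w $ j) - Im (z $ j))\<^sup>2) \<Omega>"
      by (intro Ck_on_sum Ck_on_add Ck_on_power Ck_on_diff \<Omega> Ck_on_const Ck_on_linear
          bounded_linear_compose[OF bounded_linear_Re bounded_linear_vec_nth]
          bounded_linear_compose[OF bounded_linear_Im bounded_linear_vec_nth])
    moreover have "(\<lambda>w. \<Sum>j\<in>UNIV. (Re (w $ j) - Re (z $ j))\<^sup>2 + (Im (w $ j) - Im (z $ j))\<^sup>2) = q"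
      unfolding q_def power2_norm_vec cmod_power2 by (simp add: fun_eq_iff)
    ultimately show ?thesis by simp
  qed
  have CkF: "Ck_on 1 (F j) \<Omega>" for j
  proof -
    have ne: "(q w + a) ^ ?n \<noteq> 0" for w using q0[of w] a by auto
    have "Ck_on 1 (\<lambda>w. max 0 (1 - (q w * inverse ?R) ^ ?n) ^ Suc 1 * inverse ((q w + a) ^ ?n)) \<Omega>"
      by (intro Ck_on_mult Ck_on_max_power Ck_on_diff Ck_on_const Ck_on_power Ck_on_inverse Ck_on_add \<Omega> Ck_on_mono[OF Ckq] ne) auto
    then have "Ck_on 1 (\<lambda>w. \<Phi> (q w)) \<Omega>"
      by (simp only: \<Phi>_def bump_def divide_inverse One_nat_def numeral_2_eq_2)
    from Ck_on_bounded_linear[OF bounded_linear_of_real \<Omega> this] show ?thesis unfolding F_def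
      by (intro Ck_on_mult \<Omega> Ck_on_bounded_linear[OF bounded_linear_cnj] Ck_on_diff Ck_on_const Ck_on_linear[OF bounded_linear_vec_nth])
  qed
  have F0: "F j w = 0" if "w \<in> \<Omega> - cball z r" for j w
    using qK[of w] that by (simp add: F_def \<Phi>_def bump_def)
  have int0: "(LINT w|lebesgue_on \<Omega>. h w * dbar j (F j) w) = 0" for j
    by (rule integral_holomorphic_dbar_eq_0[OF \<Omega> h CkF compact_cball K F0])
  have dF: "dbar j (F j) w = 2 * of_real (\<Phi> (q w)) + 2 * of_real ((norm (w $ j - z $ j))\<^sup>2 * d)"
    if d: "(\<Phi> has_real_derivative d) (at (q w))" for j w d
  proof -
    have q1: "(q has_derivative (\<lambda>v. 2 * ((w - z) \<bullet> v))) (at w)"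
      unfolding q_def by (rule has_derivative_norm_sq)
    have dq: "dbar j (\<lambda>x. of_real (q x)) w = 2 * (w $ j - z $ j)"
      unfolding dbar_eqI[OF has_derivative_of_real[OF q1]]
      by (simp add: inner_axis complex_eq_iff inner_complex_def)
    have "bounded_linear (\<lambda>w. cnj (w $ j))"
      by (rule bounded_linear_compose[OF bounded_linear_cnj bounded_linear_vec_nth])
    then have "((\<lambda>w. cnj (w $ j) - cnj (z $ j)) has_derivative (\<lambda>v. cnj (v $ j) - 0)) (at w)"
      by (intro has_derivative_diff bounded_linear_imp_has_derivative has_derivative_const)
    then have c1: "((\<lambda>w. cnj (w $ j - z $ j)) has_derivative (\<lambda>v. cnj (v $ j))) (at w)"
      by simp
    have dc: "dbar j (\<lambda>w. cnj (w $ j - z $ j)) w = 2"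
      unfolding dbar_eqI[OF c1] by simp
    have f\<Phi>: "(\<lambda>x. complex_of_real (\<Phi> (q x))) differentiable at w"
      by (rule differentiableI[OF has_derivative_of_real[OF has_derivative_compose[OF q1 d[unfolded has_field_derivative_def]]]])
    have "dbar j (F j) w = cnj (w $ j - z $ j) * (of_real d * (2 * (w $ j - z $ j))) + 2 * of_real (\<Phi> (q w))"
      unfolding F_def dbar_mult[OF differentiableI[OF c1] f\<Phi>] dc dbar_of_real_compose[OF d differentiableI[OF q1]] dq ..
    also have "\<dots> = 2 * of_real (\<Phi> (q w)) + 2 * (of_real d * ((w $ j - z $ j) * cnj (w $ j - z $ j)))"
      by (simp only: ac_simps)
    also have "(w $ j - z $ j) * cnj (w $ j - z $ j) = of_real ((norm (w $ j - z $ j))\<^sup>2)"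
      using complex_norm_square[of "w $ j - z $ j"] by simp
    finally show ?thesis by (simp add: mult.commute)
  qed
  have sum: "(\<Sum>j\<in>UNIV. dbar j (F j) w) = 2 * (of_real (peak ?n ?R a (q w)) - of_real (tail ?n ?R a (q w)))" for w
  proof -
    obtain d where d: "(\<Phi> has_real_derivative d) (at (q w))" "q w * d + ?n * \<Phi> (q w) = peak ?n ?R a (q w) - tail ?n ?R a (q w)"
      using bump_quotient_derivative[OF q0 a, of ?R ?n w] r unfolding \<Phi>_def[abs_def] by force
    have "(\<Sum>j\<in>UNIV. dbar j (F j) w) = 2 * of_real (q w * d + ?n * \<Phi> (q w))"
      unfolding dF[OF d(1)] sum.distrib q_def power2_norm_vec
      by (simp add: sum_distrib_left sum_distrib_right algebra_simps)
    then show ?thesis unfolding d(2) by simp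
  qed
  have supp: "bump ?n ?R (q w) = 0" "peak ?n ?R a (q w) = 0" "tail ?n ?R a (q w) = 0" if "w \<in> \<Omega> - cball z r" for w
    using qK[of w] that by (auto simp: bump_def peak_def tail_def)
  have cq: "continuous_on \<Omega> q" unfolding q_def by (intro continuous_intros)
  have pos: "q w + a \<noteq> 0" for w using q0[of w] a by linarith
  have cpk: "continuous_on \<Omega> (\<lambda>w. peak ?n ?R a (q w))" and ctl: "continuous_on \<Omega> (\<lambda>w. tail ?n ?R a (q w))"
    unfolding peak_def tail_def bump_def using pos r by (auto intro!: continuous_intros cq)
  note ch = holomorphic_in_continuous_on[OF h]
  show ip: "integrable (lebesgue_on \<Omega>) (\<lambda>w. peak ?n ?R a (q w))"
    by (rule integrable_compact_support[OF \<Omega> cpk compact_cball K supp(2)])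
  show ihp: "integrable (lebesgue_on \<Omega>) (\<lambda>w. h w * of_real (peak ?n ?R a (q w)))"
    by (rule integrable_compact_support[OF \<Omega> _ compact_cball K])
      (use supp in \<open>auto intro!: continuous_intros ch cpk\<close>)
  show iht: "integrable (lebesgue_on \<Omega>) (\<lambda>w. h w * of_real (tail ?n ?R a (q w)))"
    by (rule integrable_compact_support[OF \<Omega> _ compact_cball K])
      (use supp in \<open>auto intro!: continuous_intros ch ctl\<close>)
  have ij: "integrable (lebesgue_on \<Omega>) (\<lambda>w. h w * dbar j (F j) w)" for j
  proof (rule integrable_compact_support[OF \<Omega> _ compact_cball K])
    have "continuous_on \<Omega> (dbar j (F j))"
      using Ck_on_dbar[OF \<Omega>, of 0 "F j"] CkF[of j] by simp
    then show "continuous_on \<Omega> (\<lambda>w. h w * dbar j (F j) w)" by (intro continuous_intros ch)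
    show "h w * dbar j (F j) w = 0" if "w \<in> \<Omega> - cball z r" for w
    proof -
      have "dbar j (\<lambda>x. 0) w = dbar j (F j) w"
        by (rule dbar_cong[where S = "\<Omega> - cball z r"]) (use that \<Omega> F0 in auto)
      then show ?thesis by (simp add: dbar_def)
    qed
  qed
  have "0 = (\<Sum>j\<in>UNIV. (LINT w|lebesgue_on \<Omega>. h w * dbar j (F j) w))" using int0 by simp
  also have "\<dots> = (LINT w|lebesgue_on \<Omega>. (\<Sum>j\<in>UNIV. h w * dbar j (F j) w))"
    by (rule Bochner_Integration.integral_sum[symmetric]) (rule ij)
  also have "\<dots> = (LINT w|lebesgue_on \<Omega>. 2 * (h w * of_real (peak ?n ?R a (q w)) - h w * of_real (tail ?n ?R a (q w))))"
    by (simp add: sum_distrib_left[symmetric] sum algebra_simps)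
  also have "\<dots> = 2 * (?A - ?B)" using ihp iht by simp
  finally show "?A = ?B" by simp
qed

lemma tail_bounds:
  assumes "t \<ge> 0" "a > 0" "R > 0"
  shows "0 \<le> tail n R a t" "tail n R a t \<le> 2 * real n / R ^ n"
proof -
  have m: "0 \<le> max 0 (1 - (t / R) ^ n)" "max 0 (1 - (t / R) ^ n) \<le> 1" using assms by auto
  show "0 \<le> tail n R a t" unfolding tail_def using assms by (intro divide_nonneg_nonneg mult_nonneg_nonneg m) auto
  have "tail n R a t = (2 * real n / R ^ n) * (max 0 (1 - (t / R) ^ n) * (t / (t + a)) ^ n)"
    unfolding tail_def by (simp add: power_divide)
  also have "\<dots> \<le> (2 * real n / R ^ n) * (1 * 1)"
    using assms by (intro mult_left_mono mult_mono m power_le_one) auto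
  finally show "tail n R a t \<le> 2 * real n / R ^ n" by simp
qed

lemma peak_nonneg: "t \<ge> 0 \<Longrightarrow> a > 0 \<Longrightarrow> 0 \<le> peak n R a t"
  unfolding peak_def bump_def by (intro divide_nonneg_nonneg mult_nonneg_nonneg) auto

lemma bump_le_1: "t \<ge> 0 \<Longrightarrow> R > 0 \<Longrightarrow> bump n R t \<le> 1"
  unfolding bump_def by (intro power_le_one) auto

lemma peak_away:
  assumes "t \<ge> s" "s > 0" "a > 0" "R > 0"
  shows "peak n R a t \<le> n * a / s ^ Suc n"
  unfolding peak_def
  using bump_le_1[of t R n] assms
  by (intro frac_le mult_left_le power_mono) auto

lemma peak_core:
  assumes "0 \<le> t" "t \<le> a" "0 < a" "a \<le> R / 2" "n > 0"
  shows "n / (8 * 2 ^ n * a ^ n) \<le> peak n R a t"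
proof -
  have R: "R > 0" using assms by linarith
  have "t / R \<le> 1 / 2" using assms R by (simp add: divide_simps)
  then have "(t / R) ^ n \<le> (1 / 2) ^ n" using assms R by (intro power_mono) auto
  also have "\<dots> \<le> (1 / 2) ^ 1" using assms by (intro power_decreasing) auto
  finally have "1 / 2 \<le> max 0 (1 - (t / R) ^ n)" by auto
  then have "(1 / 2) ^ 2 \<le> bump n R t" unfolding bump_def by (rule power_mono) simp
  then have b: "1 / 4 \<le> bump n R t" by (simp add: power2_eq_square)
  have "n / (8 * 2 ^ n * a ^ n) = n * a * (1 / 4) / (2 * a) ^ Suc n"
    using assms by (simp add: power_mult_distrib)
  also have "\<dots> \<le> peak n R a t"
    unfolding peak_def using assms b by (intro frac_le mult_left_mono power_mono) auto
  finally show ?thesis .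
qed

lemma measure_ball_complex_vec:
  assumes "a > 0"
  shows "measure lebesgue (ball (z :: complex ^ 'n) (sqrt a)) = unit_ball_vol (2 * CARD('n)) * a ^ CARD('n)"
proof -
  have "sqrt a ^ (2 * CARD('n)) = a ^ CARD('n)"
    using assms by (simp add: power_mult)
  then show ?thesis
    using content_ball[of "sqrt a" z] assms by (simp add: measure_completion mult.commute)
qed

text \<open>On the ball of radius \<open>\<surd>a\<close> the peak is of size \<open>a\<^bsup>-n\<^esup>\<close>, and the volume of that ball is of size
  \<open>a\<^sup>n\<close>.\<close>

lemma peak_mass:
  fixes \<Omega> :: "(complex ^ 'n) set"
  assumes \<Omega>: "open \<Omega>" and r: "r > 0" and a: "0 < a" "a \<le> r\<^sup>2 / 2" and K: "cball z r \<subseteq> \<Omega>"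
    and ip: "integrable (lebesgue_on \<Omega>) (\<lambda>w. peak CARD('n) (r\<^sup>2) a ((norm (w - z))\<^sup>2))"
  shows "CARD('n) * unit_ball_vol (2 * CARD('n)) / (8 * 2 ^ CARD('n)) \<le>
     (LINT w|lebesgue_on \<Omega>. peak CARD('n) (r\<^sup>2) a ((norm (w - z))\<^sup>2))"
proof -
  let ?n = "CARD('n)" and ?B = "ball z (sqrt a)"
  let ?c = "?n / (8 * 2 ^ ?n * a ^ ?n)"
  have "sqrt a \<le> r" using a r by (intro real_le_lsqrt) (auto intro: order_trans)
  then have B: "?B \<subseteq> \<Omega>" using K by (meson ball_subset_cball order_trans subset_cball)
  have "?n * unit_ball_vol (2 * ?n) / (8 * 2 ^ ?n) = ?c * measure lebesgue ?B"
    unfolding measure_ball_complex_vec[OF a(1)] using a by simp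
  also have "\<dots> = (LINT w|lebesgue_on \<Omega>. ?c * indicator ?B w)"
    by (simp only: integral_mult_right_zero integrable_indicator_lebesgue_on(2)[OF \<Omega> lmeasurable_ball B])
  also have "\<dots> \<le> (LINT w|lebesgue_on \<Omega>. peak ?n (r\<^sup>2) a ((norm (w - z))\<^sup>2))"
  proof (rule integral_mono)
    show "integrable (lebesgue_on \<Omega>) (\<lambda>w. ?c * indicator ?B w)"
      by (intro integrable_mult_right integrable_indicator_lebesgue_on \<Omega> lmeasurable_ball B)
    show "?c * indicator ?B w \<le> peak ?n (r\<^sup>2) a ((norm (w - z))\<^sup>2)" for w
    proof (cases "w \<in> ?B")
      case True
      then have "norm (w - z) \<le> sqrt a" by (simp add: dist_norm norm_minus_commute)
      then have "(norm (w - z))\<^sup>2 \<le> (sqrt a)\<^sup>2" by (intro power_mono) auto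
      then have "(norm (w - z))\<^sup>2 \<le> a" using a by simp
      then show ?thesis using True peak_core[of "(norm (w - z))\<^sup>2" a "r\<^sup>2" ?n] a by simp
    next
      case False then show ?thesis using peak_nonneg[of "(norm (w - z))\<^sup>2" a] a by simp
    qed
  qed (rule ip)
  finally show ?thesis .
qed

text \<open>As \<open>a\<close> tends to zero, the integral of \<open>h\<close> against the peak approaches \<open>h z\<close> times the mass of the
  peak, and it equals an integral against the tail, which is at most \<open>2 n / r\<^bsup>2n\<^esup>\<close>. The exponent of \<open>r\<close>
  is the real dimension.\<close>

lemma holomorphic_pointwise_bound:
  fixes h :: "complex ^ 'n \<Rightarrow> complex"
  assumes \<Omega>: "open \<Omega>" and h: "holomorphic_in h \<Omega>" and ih: "integrable (lebesgue_on \<Omega>) h"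
    and r: "r > 0" and K: "cball z r \<subseteq> \<Omega>"
  shows "norm (h z) * r ^ (2 * CARD('n)) \<le>
    16 * 2 ^ CARD('n) / unit_ball_vol (2 * CARD('n)) * (LINT w|lebesgue_on \<Omega>. norm (h w))"
proof -
  let ?n = "CARD('n)" and ?R = "r\<^sup>2"
  define q where "q w = (norm (w - z))\<^sup>2" for w
  define c where "c = ?n * unit_ball_vol (2 * ?n) / (8 * 2 ^ ?n)"
  define N where "N = (LINT w|lebesgue_on \<Omega>. norm (h w))"
  have n0: "real ?n > 0" by simp
  have v0: "unit_ball_vol (2 * ?n) > 0" by simp
  have c0: "c > 0" unfolding c_def using n0 v0 by simp
  have z: "z \<in> \<Omega>" using K r by auto
  have key: "norm (h z) * c \<le> 2 * ?n / ?R ^ ?n * N + \<eta>" if \<eta>: "\<eta> > 0" for \<eta>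
  proof -
    obtain M where M: "M \<ge> 0" "\<And>x. x \<in> cball z r \<Longrightarrow> norm (h x) \<le> M"
      using compact_continuous_bound[OF compact_cball continuous_on_subset[OF holomorphic_in_continuous_on[OF h] K]] by metis
    define \<epsilon> where "\<epsilon> = \<eta> / (2 * c)"
    have e0: "\<epsilon> > 0" unfolding \<epsilon>_def using \<eta> c0 by simp
    obtain d where d: "d > 0" "\<And>w. w \<in> \<Omega> \<Longrightarrow> dist w z < d \<Longrightarrow> dist (h w) (h z) < \<epsilon>"
      using holomorphic_in_continuous_on[OF h] z e0 unfolding continuous_on_iff by metis
    \<comment> \<open>Bounds, up to the factor \<open>a\<close>, the contribution of the points at distance at least \<open>d\<close> from \<open>z\<close>.\<close>
    define B where "B = 2 * M * ?n / (d\<^sup>2) ^ Suc ?n * measure lebesgue (cball z r)"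
    have B0: "B \<ge> 0" unfolding B_def using M d by simp
    define a where "a = min (r\<^sup>2 / 2) (\<eta> / (2 * (B + 1)))"
    have a0: "0 < a" using r \<eta> B0 unfolding a_def by simp
    have a: "0 < a" "a \<le> r\<^sup>2 / 2" "a \<le> \<eta> / (2 * (B + 1))"
      using a0 unfolding a_def by (simp, intro min.cobounded1, intro min.cobounded2)
    have "B * a \<le> (B + 1) * a" using a by simp
    also have "\<dots> \<le> (B + 1) * (\<eta> / (2 * (B + 1)))" using a B0 by (intro mult_left_mono) auto
    also have "\<dots> = \<eta> / 2" using B0 by (simp add: field_simps)
    finally have Ba: "B * a \<le> \<eta> / 2" .
    define k where "k w = peak ?n ?R a (q w)" for w
    define t where "t w = tail ?n ?R a (q w)" for w
    have k0: "k w \<ge> 0" for w unfolding k_def q_def using a by (intro peak_nonneg) auto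
    have q0: "q w \<ge> 0" for w by (simp add: q_def)
    note id = integral_holomorphic_peak_eq_tail[OF \<Omega> h r a(1) K, folded q_def, folded k_def t_def]
    define m where "m = (LINT w|lebesgue_on \<Omega>. k w)"
    have mc: "c \<le> m"
      using peak_mass[OF \<Omega> r a(1,2) K, folded q_def, folded k_def, OF id(2)] unfolding c_def m_def .
    have ihk: "integrable (lebesgue_on \<Omega>) (\<lambda>w. h z * of_real (k w))"
      using id(2) by (intro integrable_mult_right integrable_of_real)
    have 1: "norm (LINT w|lebesgue_on \<Omega>. h w * of_real (t w)) \<le> 2 * ?n / ?R ^ ?n * N"
    proof -
      have "norm (LINT w|lebesgue_on \<Omega>. h w * of_real (t w)) \<le> (LINT w|lebesgue_on \<Omega>. norm (h w * of_real (t w)))"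
        by (rule integral_norm_bound)
      also have "\<dots> \<le> (LINT w|lebesgue_on \<Omega>. 2 * ?n / ?R ^ ?n * norm (h w))"
      proof (rule integral_mono)
        fix w
        have "\<bar>t w\<bar> \<le> 2 * ?n / ?R ^ ?n"
          unfolding t_def using tail_bounds[OF q0 a(1), of ?R] r by simp
        then show "norm (h w * of_real (t w)) \<le> 2 * ?n / ?R ^ ?n * norm (h w)"
          unfolding norm_mult norm_of_real by (subst mult.commute) (intro mult_right_mono, auto)
      qed (intro integrable_norm id(4) integrable_mult_right ih)+
      finally show ?thesis unfolding N_def by simp
    qed
    have 2: "norm (LINT w|lebesgue_on \<Omega>. (h w - h z) * of_real (k w)) \<le> \<epsilon> * m + B * a"
    proof -
      let ?b = "2 * M * (?n * a / (d\<^sup>2) ^ Suc ?n)"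
      have cb: "cball z r \<in> lmeasurable" by simp
      have "norm (LINT w|lebesgue_on \<Omega>. (h w - h z) * of_real (k w)) \<le> (LINT w|lebesgue_on \<Omega>. norm ((h w - h z) * of_real (k w)))"
        by (rule integral_norm_bound)
      also have "\<dots> \<le> (LINT w|lebesgue_on \<Omega>. \<epsilon> * k w + ?b * indicator (cball z r) w)"
      proof (rule integral_mono)
        show "integrable (lebesgue_on \<Omega>) (\<lambda>w. norm ((h w - h z) * of_real (k w)))"
          unfolding left_diff_distrib by (intro integrable_norm Bochner_Integration.integrable_diff id(3) ihk)
        show "integrable (lebesgue_on \<Omega>) (\<lambda>w. \<epsilon> * k w + ?b * indicator (cball z r) w)"
          by (intro Bochner_Integration.integrable_add integrable_mult_right id(2) integrable_indicator_lebesgue_on \<Omega> cb K)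
        fix w assume "w \<in> space (lebesgue_on \<Omega>)"
        then have w: "w \<in> \<Omega>" by simp
        have b0: "?b \<ge> 0" using M a d by simp
        have bi: "0 \<le> ?b * indicator (cball z r) w" by (rule mult_nonneg_nonneg[OF b0]) simp
        have nn: "norm ((h w - h z) * of_real (k w)) = norm (h w - h z) * k w"
          using k0[of w] by (simp add: norm_mult)
        consider "w \<notin> cball z r" | "dist w z < d" | "w \<in> cball z r" "dist w z \<ge> d" by fastforce
        then show "norm ((h w - h z) * of_real (k w)) \<le> \<epsilon> * k w + ?b * indicator (cball z r) w"
        proof cases
          case 1
          then have "r \<le> norm (w - z)" by (simp add: dist_norm norm_minus_commute)
          then have "?R \<le> q w" unfolding q_def using r by (intro power_mono) auto
          then have "1 \<le> (q w / ?R) ^ ?n" using r by (intro one_le_power) (simp add: divide_simps)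
          then have "k w = 0" by (simp add: k_def peak_def bump_def)
          then show ?thesis using bi by simp
        next
          case 2
          have "norm (h w - h z) * k w \<le> \<epsilon> * k w"
            using d(2)[OF w 2] k0 by (intro mult_right_mono) (auto simp: dist_norm)
          then show ?thesis unfolding nn using bi by linarith
        next
          case 3
          have "d\<^sup>2 \<le> q w" unfolding q_def using 3 d by (intro power_mono) (auto simp: dist_norm)
          then have "k w \<le> ?n * a / (d\<^sup>2) ^ Suc ?n" unfolding k_def using d a r by (intro peak_away) auto
          moreover have "norm (h w - h z) \<le> 2 * M"
            using norm_triangle_ineq4[of "h w" "h z"] M(2)[of w] M(2)[of z] 3 r by simp
          ultimately have "norm (h w - h z) * k w \<le> ?b"
            using k0 M by (intro mult_mono) auto
          then show ?thesis unfolding nn using 3 e0 k0[of w] by (simp add: add_increasing)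
        qed
      qed
      also have "\<dots> = \<epsilon> * m + ?b * measure lebesgue (cball z r)"
        using id(2) integrable_indicator_lebesgue_on[OF \<Omega> cb K]
        by (subst Bochner_Integration.integral_add) (auto simp: m_def)
      also have "\<dots> = \<epsilon> * m + B * a" unfolding B_def by simp
      finally show ?thesis .
    qed
    have "h z * of_real m = (LINT w|lebesgue_on \<Omega>. h z * of_real (k w))"
      unfolding m_def by (simp add: integral_complex_of_real)
    also have "\<dots> = (LINT w|lebesgue_on \<Omega>. h w * of_real (k w)) - (LINT w|lebesgue_on \<Omega>. (h w - h z) * of_real (k w))"
      using id(3) ihk by (subst Bochner_Integration.integral_diff[symmetric]) (auto simp: left_diff_distrib)
    finally have "norm (h z * of_real m) \<le> 2 * ?n / ?R ^ ?n * N + (\<epsilon> * m + B * a)"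
      unfolding id(1) using order_trans[OF norm_triangle_ineq4 add_mono[OF 1 2]] by simp
    then have 3: "norm (h z) * m \<le> 2 * ?n / ?R ^ ?n * N + (\<epsilon> * m + B * a)"
      using mc c0 by (simp add: norm_mult)
    have N0: "0 \<le> 2 * ?n / ?R ^ ?n * N" unfolding N_def by simp
    have ec: "\<epsilon> * c = \<eta> / 2" unfolding \<epsilon>_def using c0 by simp
    show ?thesis
    proof (cases "norm (h z) \<le> \<epsilon>")
      case True
      then have "norm (h z) * c \<le> \<epsilon> * c" using c0 by (intro mult_right_mono) auto
      then show ?thesis using ec N0 \<eta> by linarith
    next
      case False
      then have "(norm (h z) - \<epsilon>) * c \<le> (norm (h z) - \<epsilon>) * m" using mc by (intro mult_left_mono) auto
      then show ?thesis using 3 ec Ba by (simp add: algebra_simps)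
    qed
  qed
  have "norm (h z) * c \<le> 2 * ?n / ?R ^ ?n * N"
    by (rule field_le_epsilon) (rule key)
  then have "norm (h z) * r ^ (2 * ?n) \<le> 2 * ?n * N / c"
    using r c0 unfolding power_mult by (simp add: field_simps)
  also have "2 * ?n * N / c = 16 * 2 ^ ?n / unit_ball_vol (2 * ?n) * N"
    using n0 v0 unfolding c_def by (simp add: field_simps)
  finally show ?thesis unfolding N_def .
qed

section \<open>A global defining function\<close>

text \<open>The given defining function \<open>\<rho>\<close> lives near the boundary only. Near the boundary the new one is
  \<open>1 - max 0 (1 + \<rho> / c)\<^sup>m\<close>, which equals \<open>1\<close> as soon as \<open>\<rho>\<close> is at most \<open>-c\<close>; a constant \<open>c\<close> for which
  this happens on a whole shell inside \<open>\<Omega>\<close> lets it continue by \<open>1\<close> into the interior.\<close>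

lemma defining_function:
  fixes \<Omega> :: "(complex ^ 'n) set"
  assumes "smoothly_bounded_domain \<Omega>"
  obtains W s where "open W" "closure \<Omega> \<subseteq> W" "Ck_on (Suc k) s W"
    "\<And>z. z \<in> \<Omega> \<Longrightarrow> s z > (0::real)" "\<And>z. z \<in> frontier \<Omega> \<Longrightarrow> s z = 0"
    "\<And>z. z \<in> frontier \<Omega> \<Longrightarrow> frechet_derivative s (at z) \<noteq> (\<lambda>v. 0)"
proof -
  have \<Omega>: "open \<Omega>" "\<Omega> \<noteq> {}" "bounded \<Omega>" "smooth_boundary \<Omega>"
    using assms by (auto simp: smoothly_bounded_domain_def)
  obtain U and \<rho> :: "complex ^ 'n \<Rightarrow> real" where U: "open U" "frontier \<Omega> \<subseteq> U" "smooth_on \<rho> U"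
      "\<Omega> \<inter> U = {z \<in> U. \<rho> z < 0}"
      "\<And>z. z \<in> frontier \<Omega> \<Longrightarrow> frechet_derivative \<rho> (at z) \<noteq> (\<lambda>v. 0)"
    using \<Omega>(4) unfolding smooth_boundary_def by blast
  have Ck\<rho>: "Ck_on m \<rho> U" for m using U(3) by (simp add: smooth_on_def)
  let ?fr = "frontier \<Omega>"
  have cfr: "compact ?fr" using \<Omega>(3) by (simp add: compact_frontier_bounded)
  have nfr: "?fr \<noteq> {}" using \<Omega>(2,3) by (auto simp: frontier_eq_empty)
  have frn: "z \<notin> \<Omega>" if "z \<in> ?fr" for z using that \<Omega>(1) by (auto simp: frontier_def interior_open)
  have \<rho>0: "\<rho> z = 0" if z: "z \<in> ?fr" for z
  proof -
    have zU: "z \<in> U" using z U(2) by auto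
    have "\<not> \<rho> z < 0" using zU U(4) frn[OF z] by blast
    moreover have "\<not> \<rho> z > 0"
    proof
      assume "\<rho> z > 0"
      have "open (U \<inter> \<rho> -` {0<..})"
        by (rule continuous_open_preimage[OF Ck_on_continuous[OF Ck\<rho>[of 0]] U(1)]) auto
      moreover have "z \<in> closure \<Omega>" using z by (simp add: frontier_def)
      moreover have "z \<in> U \<inter> \<rho> -` {0<..}" using zU \<open>\<rho> z > 0\<close> by simp
      ultimately have "U \<inter> \<rho> -` {0<..} \<inter> \<Omega> \<noteq> {}"
        using open_Int_closure_eq_empty[of "U \<inter> \<rho> -` {0<..}" \<Omega>] by blast
      then obtain x where "x \<in> U" "\<rho> x > 0" "x \<in> \<Omega>" by auto
      then have "x \<in> {z \<in> U. \<rho> z < 0}" using U(4) by blast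
      then show False using \<open>\<rho> x > 0\<close> by simp
    qed
    ultimately show ?thesis by linarith
  qed
  obtain \<delta> where \<delta>: "\<delta> > 0" "{x. infdist x ?fr \<le> \<delta>} \<subseteq> U"
  proof -
    obtain e where e: "e > 0" "(\<Union>x\<in>?fr. cball x e) \<subseteq> U"
      using compact_subset_open_imp_cball_epsilon_subset[OF cfr U(1,2)] by auto
    have "{x. infdist x ?fr \<le> e} \<subseteq> U"
    proof
      fix x assume "x \<in> {x. infdist x ?fr \<le> e}"
      moreover obtain y where "y \<in> ?fr" "infdist x ?fr = dist x y"
        using infdist_attains_inf[OF frontier_closed nfr] by blast
      ultimately have "x \<in> cball y e" by (simp add: dist_commute)
      then show "x \<in> U" using e(2) \<open>y \<in> ?fr\<close> by blast
    qed
    then show thesis using that e(1) by blast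
  qed
  define V where "V = {x. infdist x ?fr < \<delta>}"
  \<comment> \<open>The shell on which the two definitions of \<open>s\<close> are matched.\<close>
  define D where "D = {x \<in> closure \<Omega>. \<delta> / 2 \<le> infdist x ?fr \<and> infdist x ?fr \<le> \<delta>}"
  have oV: "open V" unfolding V_def by (intro open_Collect_less continuous_intros)
  have VU: "V \<subseteq> U" using \<delta>(2) unfolding V_def by auto
  have DU: "D \<subseteq> U" using \<delta>(2) unfolding D_def by auto
  have cD: "compact D"
  proof -
    have "D = closure \<Omega> \<inter> ({x. \<delta> / 2 \<le> infdist x ?fr} \<inter> {x. infdist x ?fr \<le> \<delta>})"
      unfolding D_def by auto
    moreover have "closed ({x. \<delta> / 2 \<le> infdist x ?fr} \<inter> {x. infdist x ?fr \<le> \<delta>})"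
      by (intro closed_Int closed_Collect_le continuous_intros)
    ultimately show ?thesis using \<Omega>(3) by (simp add: compact_Int_closed)
  qed
  have D\<Omega>: "D \<subseteq> \<Omega>"
  proof
    fix x assume x: "x \<in> D"
    then have "x \<notin> ?fr" using \<delta>(1) unfolding D_def by auto
    then show "x \<in> \<Omega>" using x \<Omega>(1) unfolding D_def frontier_def by (auto simp: interior_open)
  qed
  obtain c where c: "c > 0" "\<And>x. x \<in> D \<Longrightarrow> \<rho> x \<le> - c"
  proof (cases "D = {}")
    case True then show thesis using that[of 1] by simp
  next
    case False
    obtain x where x: "x \<in> D" "\<And>y. y \<in> D \<Longrightarrow> \<rho> y \<le> \<rho> x"
      using continuous_attains_sup[OF cD False continuous_on_subset[OF Ck_on_continuous[OF Ck\<rho>[of 0]] DU]] by blast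
    have "\<rho> x < 0" using x(1) D\<Omega> DU U(4) by blast
    then show thesis using that[of "- \<rho> x"] x(2) by simp
  qed
  define s where "s z = (if z \<in> V then 1 - max 0 (1 + \<rho> z / c) ^ Suc (Suc k) else 1)" for z
  define T where "T = \<Omega> \<inter> {x. \<delta> / 2 < infdist x ?fr}"
  have oT: "open T" unfolding T_def by (intro open_Int \<Omega> open_Collect_less continuous_intros)
  have sT: "s z = 1" if "z \<in> T" for z
  proof (cases "z \<in> V")
    case True
    then have "z \<in> D" using that closure_subset[of \<Omega>] by (auto simp: T_def D_def V_def)
    then have "1 + \<rho> z / c \<le> 0" using c(1) c(2)[of z] by (simp add: field_simps)
    then show ?thesis by (simp add: s_def)
  qed (simp add: s_def)
  have CV: "Ck_on (Suc k) s V"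
  proof (rule Ck_on_cong[OF oV])
    show "Ck_on (Suc k) (\<lambda>z. 1 - max 0 (1 + \<rho> z * inverse c) ^ Suc (Suc k)) V"
      by (intro Ck_on_diff Ck_on_max_power Ck_on_add Ck_on_mult Ck_on_const oV Ck_on_subset[OF Ck\<rho> VU])
  qed (simp add: s_def divide_inverse)
  have CT: "Ck_on (Suc k) s T"
    by (rule Ck_on_cong[OF oT _ Ck_on_const[of _ 1]]) (simp add: sT)
  have frV: "?fr \<subseteq> V" using \<delta>(1) by (auto simp: V_def)
  show thesis
  proof (rule that[of "V \<union> T" s])
    show "open (V \<union> T)" using oV oT by blast
    show "closure \<Omega> \<subseteq> V \<union> T"
    proof
      fix x assume "x \<in> closure \<Omega>"
      then have "x \<in> \<Omega> \<or> x \<in> ?fr" using \<Omega>(1) by (auto simp: frontier_def interior_open)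
      then show "x \<in> V \<union> T" using frV \<delta>(1) by (cases "infdist x ?fr < \<delta>") (auto simp: V_def T_def)
    qed
    show "Ck_on (Suc k) s (V \<union> T)" by (rule Ck_on_Un[OF oV oT CV CT])
    show "s z > 0" if "z \<in> \<Omega>" for z
    proof (cases "z \<in> V")
      case True
      then have "\<rho> z < 0" using that VU U(4) by blast
      then have "max 0 (1 + \<rho> z / c) < 1" using c(1) by (simp add: divide_neg_pos)
      then have "max 0 (1 + \<rho> z / c) ^ Suc (Suc k) < 1"
        using power_strict_mono[of "max 0 (1 + \<rho> z / c)" 1 "Suc (Suc k)"] by simp
      then show ?thesis using True by (simp add: s_def)
    qed (simp add: s_def)
    show "s z = 0" if "z \<in> ?fr" for z using that frV \<rho>0[OF that] by (auto simp: s_def)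
    show "frechet_derivative s (at z) \<noteq> (\<lambda>v. 0)" if z: "z \<in> ?fr" for z
    proof -
      have zV: "z \<in> V" using z frV by auto
      let ?m = "real (Suc (Suc k)) / c"
      have \<rho>: "(\<rho> has_derivative frechet_derivative \<rho> (at z)) (at z)"
        using Ck_on_has_derivative[OF Ck\<rho>] z U(2) by blast
      have 1: "((\<lambda>z. 1 + \<rho> z / c) has_derivative (\<lambda>v. frechet_derivative \<rho> (at z) v / c)) (at z)"
        using c(1) by (auto intro!: derivative_eq_intros \<rho>)
      have 2: "((\<lambda>t. max 0 t ^ Suc (Suc k)) has_derivative (*) (real (Suc (Suc k)))) (at (1 + \<rho> z / c))"
        using has_real_derivative_max_power[of k "1 + \<rho> z / c"] by (simp add: \<rho>0[OF z] has_field_derivative_def)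
      have "((\<lambda>z. 1 - max 0 (1 + \<rho> z / c) ^ Suc (Suc k)) has_derivative (\<lambda>v. - (?m * frechet_derivative \<rho> (at z) v))) (at z)"
        using has_derivative_diff[OF has_derivative_const[of 1] has_derivative_compose[OF 1 2]] by simp
      then have "(s has_derivative (\<lambda>v. - (?m * frechet_derivative \<rho> (at z) v))) (at z)"
        by (rule has_derivative_transform_within_open[OF _ oV zV]) (simp add: s_def)
      then have "frechet_derivative s (at z) = (\<lambda>v. - (?m * frechet_derivative \<rho> (at z) v))"
        by (rule frechet_derivative_at[symmetric])
      then show ?thesis using U(5)[OF z] c(1) by (auto simp: fun_eq_iff)
    qed
  qed
qed

lemma derivative_eq_0_iff_dbar:
  fixes s :: "complex ^ 'n \<Rightarrow> real"
  assumes s: "s differentiable at z" and d: "\<And>j. dbar j (\<lambda>x. of_real (s x)) z = 0"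
  shows "frechet_derivative s (at z) = (\<lambda>v. 0)"
proof -
  let ?D = "frechet_derivative s (at z)"
  have D: "(s has_derivative ?D) (at z)" using s by (simp add: frechet_derivative_works)
  have "of_real (?D (axis j 1)) + \<i> * of_real (?D (axis j \<i>)) = 0" for j
    using d[of j] unfolding dbar_eqI[OF has_derivative_of_real[OF D]] .
  then have "?D (axis j 1) = 0 \<and> ?D (axis j \<i>) = 0" for j by (simp add: complex_eq_iff)
  then have "?D b = 0" if "b \<in> Basis" for b
    using that by (auto simp: Basis_vec_def Basis_complex_def)
  then show ?thesis
    using linear_eq_stdbasis[OF has_derivative_linear[OF D] linear_zero] by (simp add: fun_eq_iff)
qed

text \<open>Divide by \<open>N\<close>, the sum of \<open>s\<^sup>2\<close> and the squared length of the \<open>dbar\<close>-gradient of \<open>s\<close>, which has no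
  zero on the closure: the first term is positive inside, the second on the boundary, as a real
  function with vanishing \<open>dbar\<close>-gradient has vanishing derivative.\<close>

lemma transversal_fields:
  fixes \<Omega> :: "(complex ^ 'n) set"
  assumes "smoothly_bounded_domain \<Omega>"
  obtains W s w e where "open W" "closure \<Omega> \<subseteq> W" "Ck_on (Suc k) s W"
    "\<And>z. z \<in> \<Omega> \<Longrightarrow> s z > (0::real)" "\<And>z. z \<in> frontier \<Omega> \<Longrightarrow> s z = 0"
    "\<And>j. Ck_on k (w j) W" "Ck_on k e W"
    "\<And>z. z \<in> W \<Longrightarrow> (\<Sum>j\<in>UNIV. w j z * dbar j (\<lambda>x. of_real (s x)) z) + of_real (s z) * e z = 1"
proof -
  obtain W0 and s :: "complex ^ 'n \<Rightarrow> real" where W0: "open W0" "closure \<Omega> \<subseteq> W0" "Ck_on (Suc k) s W0"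
    and s: "\<And>z. z \<in> \<Omega> \<Longrightarrow> s z > 0" "\<And>z. z \<in> frontier \<Omega> \<Longrightarrow> s z = 0"
    and ds: "\<And>z. z \<in> frontier \<Omega> \<Longrightarrow> frechet_derivative s (at z) \<noteq> (\<lambda>v. 0)"
    using defining_function[OF assms, of k] by metis
  define ws where "ws j = dbar j (\<lambda>x. of_real (s x))" for j
  define N where "N z = (\<Sum>j\<in>UNIV. ws j z * cnj (ws j z)) + of_real (s z) * of_real (s z)" for z
  have Cs: "Ck_on (Suc k) (\<lambda>x. complex_of_real (s x)) W0"
    by (rule Ck_on_bounded_linear[OF bounded_linear_of_real W0(1,3)])
  have Cw: "Ck_on k (ws j) W0" for j
    unfolding ws_def by (rule Ck_on_dbar[OF W0(1) Cs])
  have Ccw: "Ck_on k (\<lambda>z. cnj (ws j z)) W0" for j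
    by (rule Ck_on_bounded_linear[OF bounded_linear_cnj W0(1) Cw])
  have CN: "Ck_on k N W0"
    unfolding N_def by (intro Ck_on_add Ck_on_sum Ck_on_mult W0(1) Cw Ccw Ck_on_Suc_imp[OF Cs])
  define W where "W = W0 \<inter> N -` (- {0})"
  have oW: "open W" unfolding W_def
    by (rule continuous_open_preimage[OF Ck_on_continuous[OF CN] W0(1)]) auto
  have WW0: "W \<subseteq> W0" by (auto simp: W_def)
  have N: "N z = of_real ((\<Sum>j\<in>UNIV. (norm (ws j z))\<^sup>2) + (s z)\<^sup>2)" for z
    unfolding N_def by (simp add: complex_norm_square[symmetric] power2_eq_square[of "s z"])
  have clW: "closure \<Omega> \<subseteq> W"
  proof
    fix z assume z: "z \<in> closure \<Omega>"
    have "N z \<noteq> 0"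
    proof
      assume "N z = 0"
      then have "(\<Sum>j\<in>UNIV. (norm (ws j z))\<^sup>2) + (s z)\<^sup>2 = 0" unfolding N using of_real_eq_0_iff by blast
      then have 0: "(\<Sum>j\<in>UNIV. (norm (ws j z))\<^sup>2) = 0" "s z = 0"
        using sum_nonneg[of UNIV "\<lambda>j. (norm (ws j z))\<^sup>2"] by (auto simp: add_nonneg_eq_0_iff)
      then have "z \<notin> \<Omega>" using s(1) by force
      then have fr: "z \<in> frontier \<Omega>" using z assms by (simp add: smoothly_bounded_domain_def frontier_def interior_open)
      have "ws j z = 0" for j using 0(1) by (simp add: sum_nonneg_eq_0_iff)
      moreover have "s differentiable at z" using Ck_on_differentiable[OF W0(3)] z W0(2) by blast
      ultimately show False using derivative_eq_0_iff_dbar[of s z] ds[OF fr] unfolding ws_def by blast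
    qed
    then show "z \<in> W" using z W0(2) by (auto simp: W_def)
  qed
  have CI: "Ck_on k (\<lambda>z. inverse (N z)) W"
    by (rule Ck_on_inverse[OF oW Ck_on_subset[OF CN WW0]]) (auto simp: W_def)
  show thesis
  proof (rule that[of W s "\<lambda>j z. cnj (ws j z) * inverse (N z)" "\<lambda>z. of_real (s z) * inverse (N z)"])
    show "Ck_on (Suc k) s W" by (rule Ck_on_subset[OF W0(3) WW0])
    show "Ck_on k (\<lambda>z. cnj (ws j z) * inverse (N z)) W" for j
      by (rule Ck_on_mult[OF oW Ck_on_subset[OF Ccw WW0] CI])
    show "Ck_on k (\<lambda>z. of_real (s z) * inverse (N z)) W"
      by (rule Ck_on_mult[OF oW Ck_on_subset[OF Ck_on_Suc_imp[OF Cs] WW0] CI])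
    fix z assume "z \<in> W"
    then have "N z \<noteq> 0" by (simp add: W_def)
    have "(\<Sum>j\<in>UNIV. cnj (ws j z) * inverse (N z) * dbar j (\<lambda>x. of_real (s x)) z) + of_real (s z) * (of_real (s z) * inverse (N z))
       = N z * inverse (N z)"
      unfolding N_def ws_def[symmetric] distrib_right sum_distrib_right by (simp add: ac_simps)
    then show "(\<Sum>j\<in>UNIV. cnj (ws j z) * inverse (N z) * dbar j (\<lambda>x. of_real (s x)) z) + of_real (s z) * (of_real (s z) * inverse (N z)) = 1"
      using \<open>N z \<noteq> 0\<close> by simp
  qed (use s oW clW in auto)
qed

section \<open>Trading weights for boundary vanishing\<close>

lemma integrable_mult_continuous_closure:
  fixes h f :: "complex ^ 'n \<Rightarrow> complex"
  assumes \<Omega>: "open \<Omega>" "bounded \<Omega>" and ih: "integrable (lebesgue_on \<Omega>) h"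
    and f: "continuous_on W f" "closure \<Omega> \<subseteq> W"
  shows "integrable (lebesgue_on \<Omega>) (\<lambda>z. h z * f z)"
proof -
  obtain M where M: "\<And>x. x \<in> closure \<Omega> \<Longrightarrow> norm (f x) \<le> M"
    using compact_continuous_bound[of "closure \<Omega>" f] \<Omega>(2) continuous_on_subset[OF f] by auto
  have fm: "f \<in> borel_measurable (lebesgue_on \<Omega>)"
    by (rule borel_measurable_lebesgue_on_continuous[OF \<Omega>(1) continuous_on_subset[OF f(1)]]) (use f(2) closure_subset in blast)
  show ?thesis
  proof (rule Bochner_Integration.integrable_bound)
    show "integrable (lebesgue_on \<Omega>) (\<lambda>z. M * norm (h z))" using ih by (intro integrable_mult_right integrable_norm)
    show "(\<lambda>z. h z * f z) \<in> borel_measurable (lebesgue_on \<Omega>)"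
      using borel_measurable_integrable[OF ih] fm by (rule borel_measurable_times)
    show "AE z in lebesgue_on \<Omega>. norm (h z * f z) \<le> norm (M * norm (h z))"
    proof (rule AE_I2)
      fix z assume "z \<in> space (lebesgue_on \<Omega>)"
      then have "norm (f z) \<le> M" using M closure_subset by auto
      then have "norm (h z) * norm (f z) \<le> norm (h z) * \<bar>M\<bar>" by (intro mult_left_mono) auto
      then show "norm (h z * f z) \<le> norm (M * norm (h z))" by (simp add: norm_mult abs_mult mult.commute)
    qed
  qed
qed

text \<open>An integrable holomorphic \<open>h\<close> need not have boundary values, but a factor \<open>s\<close> suffices for integration by
  parts: replace \<open>s\<close> by \<open>max 0 (s - \<epsilon>)\<^sup>2 / s\<close>, which has compact support in \<open>\<Omega>\<close>, and let \<open>\<epsilon>\<close> tend to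
  zero. The derivative of \<open>t \<mapsto> max 0 (t - \<epsilon>)\<^sup>2 / t\<close> is bounded uniformly in \<open>\<epsilon>\<close> and tends to \<open>1\<close>, so
  that a multiple of \<open>\<bar>h\<bar>\<close> dominates.\<close>

lemma integral_dbar_boundary_vanishing_eq_0:
  fixes h v :: "complex ^ 'n \<Rightarrow> complex" and s :: "complex ^ 'n \<Rightarrow> real"
  assumes \<Omega>: "open \<Omega>" "bounded \<Omega>" and h: "holomorphic_in h \<Omega>" and ih: "integrable (lebesgue_on \<Omega>) h"
    and W: "open W" "closure \<Omega> \<subseteq> W" and s: "Ck_on 1 s W" "\<And>z. z \<in> \<Omega> \<Longrightarrow> s z > 0" "\<And>z. z \<in> frontier \<Omega> \<Longrightarrow> s z = 0"
    and v: "Ck_on 1 v W"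
  shows "(LINT z|lebesgue_on \<Omega>. h z * dbar j (\<lambda>x. of_real (s x) * v x) z) = 0"
proof -
  have \<Omega>W: "\<Omega> \<subseteq> W" using W(2) closure_subset by blast
  let ?S = "\<lambda>x. complex_of_real (s x)"
  have CS: "Ck_on 1 ?S W" by (rule Ck_on_bounded_linear[OF bounded_linear_of_real W(1) s(1)])
  have cS': "continuous_on W (dbar j ?S)" and cv': "continuous_on W (dbar j v)"
    using Ck_on_dbar[OF W(1), of 0] CS v by simp_all
  have cS: "continuous_on W ?S" and cv: "continuous_on W v"
    using Ck_on_continuous CS v by blast+
  define \<beta> where "\<beta> k t = max 0 (t - 1 / real (Suc k)) ^ 2 * inverse t" for k and t :: real
  define \<beta>' where "\<beta>' k t = 2 * (max 0 (t - 1 / real (Suc k)) / t) - (max 0 (t - 1 / real (Suc k)) / t) ^ 2" for k and t :: real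
  have d\<beta>: "(\<beta> k has_real_derivative \<beta>' k t) (at t)" if "t > 0" for k t
  proof -
    have 1: "((\<lambda>t. t - 1 / real (Suc k)) has_real_derivative 1) (at t)"
      by (auto intro!: derivative_eq_intros)
    have 2: "((\<lambda>t. max 0 t ^ 2) has_real_derivative 2 * max 0 (t - 1 / real (Suc k))) (at (t - 1 / real (Suc k)))"
      using has_real_derivative_max_power[of 0 "t - 1 / real (Suc k)"] by (simp add: numeral_2_eq_2)
    have 3: "((\<lambda>t. inverse t) has_real_derivative - (inverse t ^ 2)) (at t)"
      using DERIV_inverse[of t] that by (simp add: numeral_2_eq_2)
    show ?thesis unfolding \<beta>_def[abs_def]
      by (rule DERIV_cong[OF DERIV_mult[OF DERIV_chain2[OF 2 1] 3]])
        (simp add: \<beta>'_def divide_inverse power_mult_distrib power2_eq_square algebra_simps)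
  qed
  have x01: "0 \<le> max 0 (t - 1 / real (Suc k)) / t" "max 0 (t - 1 / real (Suc k)) / t \<le> 1" if "t > 0" for t k
    using that by (auto simp: divide_simps)
  have b\<beta>: "\<bar>\<beta> k t\<bar> \<le> t" if "t > 0" for k t
  proof -
    have "\<beta> k t = (max 0 (t - 1 / real (Suc k)) / t) ^ 2 * t"
      using that by (simp add: \<beta>_def power2_eq_square field_simps)
    moreover have "(max 0 (t - 1 / real (Suc k)) / t) ^ 2 \<le> 1" by (rule power_le_one[OF x01[OF that]])
    ultimately show ?thesis using that by (simp add: abs_mult mult_le_cancel_right1 del: of_nat_Suc)
  qed
  have b\<beta>': "\<bar>\<beta>' k t\<bar> \<le> 3" if "t > 0" for k t
    using x01[OF that, of k] power_le_one[OF x01[OF that, of k], of 2]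
      zero_le_power2[of "max 0 (t - 1 / real (Suc k)) / t"] unfolding \<beta>'_def by linarith
  have lim0: "(\<lambda>k. max 0 (t - 1 / real (Suc k))) \<longlonglongrightarrow> t" if "t > 0" for t :: real
  proof -
    have "(\<lambda>k. max 0 (t - 1 / real (Suc k))) \<longlonglongrightarrow> max 0 (t - 0)"
      by (intro tendsto_intros LIMSEQ_Suc[OF lim_1_over_n])
    then show ?thesis using that by simp
  qed
  have l\<beta>: "(\<lambda>k. \<beta> k t) \<longlonglongrightarrow> t" if "t > 0" for t
  proof -
    have "(\<lambda>k. \<beta> k t) \<longlonglongrightarrow> t ^ 2 * inverse t" unfolding \<beta>_def by (intro tendsto_intros lim0 that)
    moreover have "t ^ 2 * inverse t = t" using that by (simp add: power2_eq_square)
    ultimately show ?thesis by simp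
  qed
  have l\<beta>': "(\<lambda>k. \<beta>' k t) \<longlonglongrightarrow> 1" if "t > 0" for t
  proof -
    have "(\<lambda>k. \<beta>' k t) \<longlonglongrightarrow> 2 * (t / t) - (t / t) ^ 2" unfolding \<beta>'_def
      using that by (intro tendsto_intros lim0) auto
    then show ?thesis using that by simp
  qed
  define F where "F k z = of_real (\<beta> k (s z)) * v z" for k z
  have CF: "Ck_on 1 (F k) \<Omega>" for k
  proof -
    have sne: "s z \<noteq> 0" if "z \<in> \<Omega>" for z using s(2)[OF that] by simp
    note s1 = Ck_on_subset[OF s(1) \<Omega>W]
    have "Ck_on 1 (\<lambda>z. max 0 (s z - 1 / real (Suc k)) ^ Suc 1 * inverse (s z)) \<Omega>"
      by (intro Ck_on_mult Ck_on_max_power Ck_on_diff Ck_on_const Ck_on_inverse \<Omega> s1 sne)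
    then have "Ck_on 1 (\<lambda>z. \<beta> k (s z)) \<Omega>" by (simp only: \<beta>_def One_nat_def numeral_2_eq_2)
    from Ck_on_bounded_linear[OF bounded_linear_of_real \<Omega>(1) this]
    show ?thesis unfolding F_def by (rule Ck_on_mult[OF \<Omega>(1) _ Ck_on_subset[OF v \<Omega>W]])
  qed
  have dF: "dbar j (F k) z = of_real (\<beta> k (s z)) * dbar j v z + of_real (\<beta>' k (s z)) * dbar j ?S z * v z"
    if z: "z \<in> \<Omega>" for k z
  proof -
    have sd: "s differentiable at z" and vd: "v differentiable at z"
      using s(1) v z \<Omega>W by auto
    note d = d\<beta>[OF s(2)[OF z]]
    have sh: "(s has_derivative frechet_derivative s (at z)) (at z)" using sd by (simp add: frechet_derivative_works)
    have "(\<lambda>x. complex_of_real (\<beta> k (s x))) differentiable at z"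
      by (rule differentiableI[OF has_derivative_of_real[OF has_derivative_compose[OF sh d[unfolded has_field_derivative_def]]]])
    from dbar_mult[OF this vd, of j] show ?thesis
      unfolding F_def dbar_of_real_compose[OF d sd] by (simp add: ac_simps)
  qed
  have int0: "(LINT z|lebesgue_on \<Omega>. h z * dbar j (F k) z) = 0" for k
  proof (rule integral_holomorphic_dbar_eq_0[OF \<Omega>(1) h CF])
    let ?K = "closure \<Omega> \<inter> s -` {1 / real (Suc k)..}"
    have "closed ?K"
      by (rule continuous_closed_preimage[OF continuous_on_subset[OF Ck_on_continuous[OF s(1)] W(2)]]) auto
    then have "compact (closure \<Omega> \<inter> ?K)" using \<Omega>(2) by (intro compact_Int_closed) auto
    then show "compact ?K" by (simp add: Int_absorb1)
    show "?K \<subseteq> \<Omega>"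
    proof
      fix z assume z: "z \<in> ?K"
      then have "s z \<noteq> 0" by (auto simp del: of_nat_Suc)
      then have "z \<notin> frontier \<Omega>" using s(3) by blast
      then show "z \<in> \<Omega>" using z \<Omega>(1) by (simp add: frontier_def interior_open)
    qed
    show "F k z = 0" if "z \<in> \<Omega> - ?K" for z
      using that closure_subset[of \<Omega>] by (auto simp: F_def \<beta>_def)
  qed
  define w where "w z = norm (h z * (?S z * dbar j v z)) + 3 * norm (h z * (dbar j ?S z * v z))" for z
  have i1: "integrable (lebesgue_on \<Omega>) (\<lambda>z. h z * (?S z * dbar j v z))"
    by (rule integrable_mult_continuous_closure[OF \<Omega> ih _ W(2)]) (intro continuous_intros cS cv')
  have i2: "integrable (lebesgue_on \<Omega>) (\<lambda>z. h z * (dbar j ?S z * v z))"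
    by (rule integrable_mult_continuous_closure[OF \<Omega> ih _ W(2)]) (intro continuous_intros cS' cv)
  have iw: "integrable (lebesgue_on \<Omega>) w"
    unfolding w_def by (intro Bochner_Integration.integrable_add integrable_mult_right integrable_norm i1 i2)
  have dSv: "dbar j (\<lambda>x. ?S x * v x) z = ?S z * dbar j v z + dbar j ?S z * v z" if "z \<in> \<Omega>" for z
    using CS v that \<Omega>W by (intro dbar_mult) auto
  have hm: "h \<in> borel_measurable (lebesgue_on \<Omega>)" using ih by auto
  have m: "(\<lambda>z. h z * dbar j f z) \<in> borel_measurable (lebesgue_on \<Omega>)" if "Ck_on 1 f \<Omega>" for f
    using Ck_on_dbar[OF \<Omega>(1), of 0 f j] that
    by (intro borel_measurable_times[OF hm borel_measurable_lebesgue_on_continuous[OF \<Omega>(1)]]) simp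
  have "(\<lambda>k. LINT z|lebesgue_on \<Omega>. h z * dbar j (F k) z) \<longlonglongrightarrow> (LINT z|lebesgue_on \<Omega>. h z * dbar j (\<lambda>x. ?S x * v x) z)"
  proof (rule integral_dominated_convergence[where w = w])
    show "(\<lambda>z. h z * dbar j (\<lambda>x. ?S x * v x) z) \<in> borel_measurable (lebesgue_on \<Omega>)"
      by (rule m[OF Ck_on_subset[OF Ck_on_mult[OF W(1) CS v] \<Omega>W]])
    show "AE z in lebesgue_on \<Omega>. (\<lambda>k. h z * dbar j (F k) z) \<longlonglongrightarrow> h z * dbar j (\<lambda>x. ?S x * v x) z"
    proof (rule AE_I2)
      fix z assume "z \<in> space (lebesgue_on \<Omega>)"
      then have z: "z \<in> \<Omega>" by simp
      have "(\<lambda>k. h z * (of_real (\<beta> k (s z)) * dbar j v z + of_real (\<beta>' k (s z)) * dbar j ?S z * v z))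
        \<longlonglongrightarrow> h z * (of_real (s z) * dbar j v z + of_real 1 * dbar j ?S z * v z)"
        by (intro tendsto_intros l\<beta> l\<beta>' s(2) z)
      then show "(\<lambda>k. h z * dbar j (F k) z) \<longlonglongrightarrow> h z * dbar j (\<lambda>x. ?S x * v x) z"
        by (simp add: dF[OF z] dSv[OF z])
    qed
    show "AE z in lebesgue_on \<Omega>. norm (h z * dbar j (F k) z) \<le> w z" for k
    proof (rule AE_I2)
      fix z assume "z \<in> space (lebesgue_on \<Omega>)"
      then have z: "z \<in> \<Omega>" by simp
      have "norm (of_real (\<beta> k (s z)) * (h z * dbar j v z)) \<le> norm (h z * (?S z * dbar j v z))"
        using mult_right_mono[OF b\<beta>[OF s(2)[OF z], of k] norm_ge_zero[of "h z * dbar j v z"]] s(2)[OF z]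
        by (simp add: norm_mult ac_simps)
      moreover have "norm (of_real (\<beta>' k (s z)) * (h z * (dbar j ?S z * v z))) \<le> 3 * norm (h z * (dbar j ?S z * v z))"
        using mult_right_mono[OF b\<beta>'[OF s(2)[OF z], of k] norm_ge_zero[of "h z * (dbar j ?S z * v z)"]]
        by (simp add: norm_mult)
      moreover have "h z * dbar j (F k) z = of_real (\<beta> k (s z)) * (h z * dbar j v z) + of_real (\<beta>' k (s z)) * (h z * (dbar j ?S z * v z))"
        unfolding dF[OF z] by (simp add: algebra_simps)
      ultimately show "norm (h z * dbar j (F k) z) \<le> w z"
        unfolding w_def by (simp only:) (rule norm_triangle_le, rule add_mono)
    qed
  qed (rule m[OF CF], rule iw)
  then show ?thesis unfolding int0 by (simp add: LIMSEQ_const_iff)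
qed

text \<open>Let \<open>b\<close> be the factor after \<open>N\<close> steps. Apply the previous lemma to \<open>v = s\<^sup>N w\<^sub>j b\<close> and sum over \<open>j\<close>.
  By the product rule and the relation between the \<open>w\<^sub>j\<close> and \<open>e\<close>, the integrand is \<open>h\<close> times
  \<open>(N + 1) (s\<^sup>N b - s\<^bsup>N+1\<^esup> b')\<close>, where \<open>b'\<close> contains first derivatives of \<open>w\<^sub>j b\<close>. Each step thus
  costs one derivative.\<close>

lemma moment_reduction:
  fixes \<Omega> :: "(complex ^ 'n) set" and s :: "complex ^ 'n \<Rightarrow> real"
  assumes \<Omega>: "open \<Omega>" "bounded \<Omega>" and W: "open W" "closure \<Omega> \<subseteq> W"
    and s: "Ck_on 1 s W" "\<And>z. z \<in> \<Omega> \<Longrightarrow> s z > 0" "\<And>z. z \<in> frontier \<Omega> \<Longrightarrow> s z = 0"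
    and w: "\<And>j. Ck_on K (w j) W" and e: "Ck_on K e W"
    and eq: "\<And>z. z \<in> W \<Longrightarrow> (\<Sum>j\<in>UNIV. w j z * dbar j (\<lambda>x. of_real (s x)) z) + of_real (s z) * e z = 1"
    and N: "N \<le> K"
  shows "\<exists>b. Ck_on (K - N) b W \<and> (\<forall>h. holomorphic_in h \<Omega> \<longrightarrow> integrable (lebesgue_on \<Omega>) h \<longrightarrow>
    (LINT z|lebesgue_on \<Omega>. h z) = (LINT z|lebesgue_on \<Omega>. h z * (of_real (s z) ^ N * b z)))"
  using N
proof (induction N)
  case 0
  show ?case by (rule exI[of _ "\<lambda>z. 1"]) (simp add: Ck_on_const)
next
  case (Suc N)
  let ?S = "\<lambda>x. complex_of_real (s x)"
  have \<Omega>W: "\<Omega> \<subseteq> W" using W(2) closure_subset by blast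
  obtain l where l: "K - N = Suc l" "K - Suc N = l" "Suc l \<le> K" using Suc.prems by (cases "K - N") auto
  obtain b where b: "Ck_on (Suc l) b W" and int: "\<And>h. holomorphic_in h \<Omega> \<Longrightarrow> integrable (lebesgue_on \<Omega>) h \<Longrightarrow>
    (LINT z|lebesgue_on \<Omega>. h z) = (LINT z|lebesgue_on \<Omega>. h z * (?S z ^ N * b z))"
    using Suc.IH Suc.prems unfolding l(1) by auto
  define u where "u j z = w j z * b z" for j z
  have u: "Ck_on (Suc l) (u j) W" for j
    unfolding u_def by (rule Ck_on_mult[OF W(1) Ck_on_mono[OF w l(3)] b])
  define b' where "b' z = e z * b z - (\<Sum>j\<in>UNIV. dbar j (u j) z) * inverse (of_nat (Suc N))" for z
  have du: "Ck_on l (dbar j (u j)) W" for j by (rule Ck_on_dbar[OF W(1) u])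
  have b': "Ck_on l b' W"
    unfolding b'_def
    by (intro Ck_on_diff Ck_on_mult Ck_on_sum W(1) du Ck_on_const Ck_on_Suc_imp[OF b] Ck_on_mono[OF e]) (use l in auto)
  have CS: "Ck_on 1 ?S W" by (rule Ck_on_bounded_linear[OF bounded_linear_of_real W(1) s(1)])
  have u1: "Ck_on 1 (u j) W" for j by (rule Ck_on_mono[OF u]) simp
  have v: "Ck_on 1 (\<lambda>z. ?S z ^ N * u j z) W" for j
    by (intro Ck_on_mult Ck_on_power W(1) CS u1)
  have key: "(\<Sum>j\<in>UNIV. dbar j (\<lambda>x. ?S x * (?S x ^ N * u j x)) z) = of_nat (Suc N) * (?S z ^ N * b z - ?S z ^ Suc N * b' z)"
    if z: "z \<in> \<Omega>" for z
  proof -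
    have zW: "z \<in> W" using z \<Omega>W by blast
    have sd: "s differentiable at z" using s(1) zW by simp
    have pw: "dbar j (\<lambda>x. ?S x ^ Suc N) z = of_nat (Suc N) * ?S z ^ N * dbar j ?S z" for j
      using dbar_of_real_compose[OF _ sd, of "\<lambda>t. t ^ Suc N", OF DERIV_pow] by simp
    have dp: "(\<lambda>x. ?S x ^ Suc N) differentiable at z"
      by (rule Ck_on_differentiable[OF Ck_on_power[OF W(1) CS[unfolded One_nat_def]] zW])
    have "dbar j (\<lambda>x. ?S x * (?S x ^ N * u j x)) z = ?S z ^ Suc N * dbar j (u j) z + of_nat (Suc N) * ?S z ^ N * b z * (w j z * dbar j ?S z)" for j
      using dbar_mult[OF dp Ck_on_differentiable[OF u1[unfolded One_nat_def] zW], of j j] unfolding pw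
      by (simp add: u_def[of j z] ac_simps)
    then have "(\<Sum>j\<in>UNIV. dbar j (\<lambda>x. ?S x * (?S x ^ N * u j x)) z) =
        ?S z ^ Suc N * (\<Sum>j\<in>UNIV. dbar j (u j) z) + of_nat (Suc N) * ?S z ^ N * b z * (\<Sum>j\<in>UNIV. w j z * dbar j ?S z)"
      by (simp add: sum.distrib sum_distrib_left)
    also have "(\<Sum>j\<in>UNIV. w j z * dbar j ?S z) = 1 - ?S z * e z"
      using eq[OF zW] by (simp add: eq_diff_eq)
    also have "(\<Sum>j\<in>UNIV. dbar j (u j) z) = of_nat (Suc N) * (e z * b z - b' z)"
      by (simp add: b'_def field_simps del: of_nat_Suc)
    finally show ?thesis by (simp add: algebra_simps del: of_nat_Suc)
  qed
  have "(LINT z|lebesgue_on \<Omega>. h z) = (LINT z|lebesgue_on \<Omega>. h z * (?S z ^ Suc N * b' z))"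
    if h: "holomorphic_in h \<Omega>" and ih: "integrable (lebesgue_on \<Omega>) h" for h
  proof -
    note imc = integrable_mult_continuous_closure[OF \<Omega> ih _ W(2)]
    have cS: "continuous_on W ?S" by (rule Ck_on_continuous[OF CS])
    have i1: "integrable (lebesgue_on \<Omega>) (\<lambda>z. h z * (?S z ^ N * b z))"
      by (rule imc) (intro continuous_intros cS Ck_on_continuous[OF b])
    have i2: "integrable (lebesgue_on \<Omega>) (\<lambda>z. h z * (?S z ^ Suc N * b' z))"
      by (rule imc) (intro continuous_intros cS Ck_on_continuous[OF b'])
    have iv: "integrable (lebesgue_on \<Omega>) (\<lambda>z. h z * dbar j (\<lambda>x. ?S x * (?S x ^ N * u j x)) z)" for j
    proof (rule imc)
      have "Ck_on (Suc 0) (\<lambda>x. ?S x * (?S x ^ N * u j x)) W"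
        using Ck_on_mult[OF W(1) CS v[of j]] by simp
      then show "continuous_on W (dbar j (\<lambda>x. ?S x * (?S x ^ N * u j x)))"
        using Ck_on_dbar[OF W(1)] Ck_on_continuous by blast
    qed
    have "0 = (\<Sum>j\<in>UNIV. (LINT z|lebesgue_on \<Omega>. h z * dbar j (\<lambda>x. ?S x * (?S x ^ N * u j x)) z))"
      by (simp add: integral_dbar_boundary_vanishing_eq_0[OF \<Omega> h ih W s v])
    also have "\<dots> = (LINT z|lebesgue_on \<Omega>. (\<Sum>j\<in>UNIV. h z * dbar j (\<lambda>x. ?S x * (?S x ^ N * u j x)) z))"
      by (rule Bochner_Integration.integral_sum[symmetric]) (rule iv)
    also have "\<dots> = (LINT z|lebesgue_on \<Omega>. of_nat (Suc N) * (h z * (?S z ^ N * b z) - h z * (?S z ^ Suc N * b' z)))"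
    proof (rule Bochner_Integration.integral_cong[OF refl])
      fix z assume "z \<in> space (lebesgue_on \<Omega>)"
      then have z: "z \<in> \<Omega>" by simp
      show "(\<Sum>j\<in>UNIV. h z * dbar j (\<lambda>x. ?S x * (?S x ^ N * u j x)) z) =
          of_nat (Suc N) * (h z * (?S z ^ N * b z) - h z * (?S z ^ Suc N * b' z))"
        unfolding sum_distrib_left[symmetric] key[OF z] by (simp add: algebra_simps del: of_nat_Suc)
    qed
    also have "\<dots> = of_nat (Suc N) * ((LINT z|lebesgue_on \<Omega>. h z * (?S z ^ N * b z)) - (LINT z|lebesgue_on \<Omega>. h z * (?S z ^ Suc N * b' z)))"
      using i1 i2 by simp
    finally show ?thesis using int[OF h ih] by (simp del: of_nat_Suc)
  qed
  then show ?case using b' unfolding l(2) by blast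
qed

lemma ball_infdist_frontier_subset:
  fixes \<Omega> :: "'a::euclidean_space set"
  assumes "z \<in> \<Omega>" shows "ball z (infdist z (frontier \<Omega>)) \<subseteq> \<Omega>"
proof (rule ccontr)
  assume n: "\<not> ball z (infdist z (frontier \<Omega>)) \<subseteq> \<Omega>"
  then have "infdist z (frontier \<Omega>) > 0" by (metis ball_empty empty_subsetI not_le)
  then have "z \<in> ball z (infdist z (frontier \<Omega>))" by simp
  then have "ball z (infdist z (frontier \<Omega>)) \<inter> \<Omega> \<noteq> {}" using assms by blast
  moreover have "ball z (infdist z (frontier \<Omega>)) - \<Omega> \<noteq> {}" using n by auto
  ultimately have "ball z (infdist z (frontier \<Omega>)) \<inter> frontier \<Omega> \<noteq> {}"
    by (intro connected_Int_frontier) auto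
  then obtain y where "y \<in> frontier \<Omega>" "dist z y < infdist z (frontier \<Omega>)" by auto
  then show False using infdist_le[of y "frontier \<Omega>" z] by linarith
qed

text \<open>Integrate the bounded derivative of \<open>s\<close> along the segment to a nearest boundary point, which stays in
  the closure.\<close>

lemma boundary_vanishing_le_infdist:
  fixes s :: "'a::euclidean_space \<Rightarrow> real"
  assumes \<Omega>: "open \<Omega>" "bounded \<Omega>" "\<Omega> \<noteq> {}" and W: "open W" "closure \<Omega> \<subseteq> W"
    and s: "Ck_on 1 s W" "\<And>z. z \<in> frontier \<Omega> \<Longrightarrow> s z = 0"
  obtains L where "L \<ge> 0" "\<And>z. z \<in> \<Omega> \<Longrightarrow> \<bar>s z\<bar> \<le> L * infdist z (frontier \<Omega>)"
proof -
  let ?D = "\<lambda>x. frechet_derivative s (at x)"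
  have "continuous_on W (\<lambda>x. \<Sum>b\<in>Basis. \<bar>?D x b\<bar>)"
    using s(1) by (intro continuous_intros) simp
  then obtain L where L: "L \<ge> 0" "\<And>x. x \<in> closure \<Omega> \<Longrightarrow> norm (\<Sum>b\<in>Basis. \<bar>?D x b\<bar>) \<le> L"
    using compact_continuous_bound[of "closure \<Omega>" "\<lambda>x. \<Sum>b\<in>Basis. \<bar>?D x b\<bar>"] \<Omega>(2) continuous_on_subset[OF _ W(2)] by auto
  have on: "onorm (?D x) \<le> L" if x: "x \<in> closure \<Omega>" for x
  proof (rule onorm_le)
    fix v
    have sd: "(s has_derivative ?D x) (at x)" using Ck_on_has_derivative[OF s(1)[unfolded One_nat_def]] x W(2) by blast
    have "?D x v = (\<Sum>b\<in>Basis. (v \<bullet> b) * ?D x b)"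
      using linear_sum[OF has_derivative_linear[OF sd], of "\<lambda>b. (v \<bullet> b) *\<^sub>R b" Basis]
      by (simp add: euclidean_representation linear_cmul[OF has_derivative_linear[OF sd]])
    also have "norm \<dots> \<le> (\<Sum>b\<in>Basis. \<bar>?D x b\<bar> * norm v)"
      by (rule sum_norm_le) (simp add: abs_mult mult.commute mult_right_mono Basis_le_norm)
    also have "\<dots> \<le> L * norm v"
      unfolding sum_distrib_right[symmetric] using L(2)[OF x] by (intro mult_right_mono) auto
    finally show "norm (?D x v) \<le> L * norm v" .
  qed
  have "frontier \<Omega> \<noteq> {}" using \<Omega>(2,3) by (auto simp: frontier_eq_empty)
  have "\<bar>s z\<bar> \<le> L * infdist z (frontier \<Omega>)" if z: "z \<in> \<Omega>" for z
  proof -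
    obtain y where y: "y \<in> frontier \<Omega>" "infdist z (frontier \<Omega>) = dist z y"
      using infdist_attains_inf[OF frontier_closed \<open>frontier \<Omega> \<noteq> {}\<close>] by blast
    have "ball z (dist z y) \<subseteq> closure \<Omega>"
      using ball_infdist_frontier_subset[OF z] y(2) closure_subset by fastforce
    moreover have "closed_segment z y \<subseteq> insert y (ball z (dist z y))"
    proof
      fix x assume "x \<in> closed_segment z y"
      then show "x \<in> insert y (ball z (dist z y))"
        by (cases "x = y") (auto simp: closed_segment_eq_open dest!: dist_decreases_open_segment intro: dist_in_open_segment)
    qed
    moreover have "y \<in> closure \<Omega>" using y(1) by (simp add: frontier_def)
    ultimately have seg: "closed_segment z y \<subseteq> closure \<Omega>" by blast
    have "norm (s z - s y) \<le> L * norm (z - y)"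
    proof (rule differentiable_bound[OF convex_closed_segment])
      show "(s has_derivative ?D x) (at x within closed_segment z y)" if "x \<in> closed_segment z y" for x
        using has_derivative_at_withinI[OF Ck_on_has_derivative[OF s(1)[unfolded One_nat_def]]] that seg W(2) by blast
      show "onorm (?D x) \<le> L" if "x \<in> closed_segment z y" for x using on that seg by blast
    qed auto
    then show ?thesis using s(2)[OF y(1)] y(2) by (simp add: dist_norm)
  qed
  then show thesis using that L(1) by blast
qed

text \<open>Apply the pointwise bound on the ball of half the distance to the boundary.\<close>

lemma weighted_sup_bound:
  fixes \<Omega> :: "(complex ^ 'n) set" and s :: "complex ^ 'n \<Rightarrow> real"
  assumes \<Omega>: "open \<Omega>" "bounded \<Omega>" "\<Omega> \<noteq> {}" and W: "open W" "closure \<Omega> \<subseteq> W"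
    and s: "Ck_on 1 s W" "\<And>z. z \<in> frontier \<Omega> \<Longrightarrow> s z = 0"
  obtains C where "C \<ge> 0" "\<And>h z. holomorphic_in h \<Omega> \<Longrightarrow> integrable (lebesgue_on \<Omega>) h \<Longrightarrow> z \<in> \<Omega> \<Longrightarrow>
    norm (h z) * \<bar>s z\<bar> ^ (2 * CARD('n)) \<le> C * (LINT w|lebesgue_on \<Omega>. norm (h w))"
proof -
  obtain L where L: "L \<ge> 0" "\<And>z. z \<in> \<Omega> \<Longrightarrow> \<bar>s z\<bar> \<le> L * infdist z (frontier \<Omega>)"
    using boundary_vanishing_le_infdist[OF assms] by metis
  let ?n = "2 * CARD('n)"
  let ?C = "16 * 2 ^ CARD('n) / unit_ball_vol (2 * CARD('n))"
  have fr: "frontier \<Omega> \<noteq> {}" using \<Omega>(2,3) by (auto simp: frontier_eq_empty)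
  show thesis
  proof (rule that[of "(2 * L) ^ ?n * ?C"])
    show "0 \<le> (2 * L) ^ ?n * ?C" using L(1) by simp
    fix h z assume h: "holomorphic_in h \<Omega>" "integrable (lebesgue_on \<Omega>) h" and z: "z \<in> \<Omega>"
    define r where "r = infdist z (frontier \<Omega>) / 2"
    have "z \<notin> frontier \<Omega>" using z \<Omega>(1) by (simp add: frontier_def interior_open)
    then have r: "r > 0" unfolding r_def using infdist_pos_not_in_closed[OF frontier_closed fr] by simp
    have "cball z r \<subseteq> ball z (infdist z (frontier \<Omega>))" using r by (auto simp: r_def)
    then have K: "cball z r \<subseteq> \<Omega>" using ball_infdist_frontier_subset[OF z] by blast
    have "\<bar>s z\<bar> ^ ?n \<le> (2 * L * r) ^ ?n" using L(2)[OF z] by (intro power_mono) (auto simp: r_def)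
    then have "norm (h z) * \<bar>s z\<bar> ^ ?n \<le> norm (h z) * ((2 * L) ^ ?n * r ^ ?n)"
      unfolding power_mult_distrib by (intro mult_left_mono) auto
    also have "\<dots> = (2 * L) ^ ?n * (norm (h z) * r ^ ?n)" by (simp only: ac_simps)
    also have "\<dots> \<le> (2 * L) ^ ?n * (?C * (LINT w|lebesgue_on \<Omega>. norm (h w)))"
      using holomorphic_pointwise_bound[OF \<Omega>(1) h r K] L(1) by (intro mult_left_mono) auto
    finally show "norm (h z) * \<bar>s z\<bar> ^ ?n \<le> (2 * L) ^ ?n * ?C * (LINT w|lebesgue_on \<Omega>. norm (h w))"
      by (simp only: mult.assoc)
  qed
qed

section \<open>The Friedrichs operator\<close>

lemma holomorphic_in_mult:
  assumes "holomorphic_in f \<Omega>" "holomorphic_in g \<Omega>" shows "holomorphic_in (\<lambda>z. f z * g z) \<Omega>"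
  unfolding holomorphic_in_def
proof
  fix z assume z: "z \<in> \<Omega>"
  note F = holomorphic_in_derivative[OF assms(1) z] and G = holomorphic_in_derivative[OF assms(2) z]
  show "\<exists>L. ((\<lambda>z. f z * g z) has_derivative L) (at z) \<and> (\<forall>c v. L (c *s v) = c * L v)"
    by (rule exI, rule conjI[OF has_derivative_mult[OF F(1) G(1)]]) (simp add: F(2) G(2) algebra_simps)
qed

lemma Lp_2_iff:
  "f \<in> Lp 2 \<Omega> \<longleftrightarrow> f \<in> borel_measurable (lebesgue_on \<Omega>) \<and> integrable (lebesgue_on \<Omega>) (\<lambda>z. (norm (f z))\<^sup>2)"
  by (simp add: Lp_def)

lemma Lp_2_cnj: "f \<in> Lp 2 \<Omega> \<Longrightarrow> (\<lambda>z. cnj (f z)) \<in> Lp 2 \<Omega>"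
  by (simp add: Lp_2_iff borel_measurable_continuous_on[OF continuous_on_cnj[OF continuous_on_id]])

lemma integrable_mult_Lp_2:
  assumes "f \<in> Lp 2 \<Omega>" "g \<in> Lp 2 \<Omega>" shows "integrable (lebesgue_on \<Omega>) (\<lambda>z. f z * g z)"
proof (rule Bochner_Integration.integrable_bound)
  show "integrable (lebesgue_on \<Omega>) (\<lambda>z. (norm (f z))\<^sup>2 + (norm (g z))\<^sup>2)"
    using assms by (auto simp: Lp_2_iff)
  show "(\<lambda>z. f z * g z) \<in> borel_measurable (lebesgue_on \<Omega>)" using assms by (auto simp: Lp_2_iff)
  have "norm (f z * g z) \<le> norm ((norm (f z))\<^sup>2 + (norm (g z))\<^sup>2)" for z
    using sum_squares_bound[of "norm (f z)" "norm (g z)"] mult_nonneg_nonneg[OF norm_ge_zero[of "f z"] norm_ge_zero[of "g z"]]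
    unfolding norm_mult real_norm_def by linarith
  then show "AE z in lebesgue_on \<Omega>. norm (f z * g z) \<le> norm ((norm (f z))\<^sup>2 + (norm (g z))\<^sup>2)" by simp
qed

lemma Lp_norm_1: "Lp_norm 1 \<Omega> f = (LINT z|lebesgue_on \<Omega>. norm (f z))"
  unfolding Lp_norm_def by simp

lemma bounded_measurable_Lp:
  assumes \<Omega>: "open \<Omega>" "bounded \<Omega>" and f: "f \<in> borel_measurable (lebesgue_on \<Omega>)" "\<And>z. z \<in> \<Omega> \<Longrightarrow> norm (f z) \<le> A"
    and A: "A \<ge> 0" and r: "r > 0"
  shows "f \<in> Lp r \<Omega>" "Lp_norm r \<Omega> f \<le> A * measure lebesgue \<Omega> powr (1 / r)"
proof -
  have lm: "\<Omega> \<in> lmeasurable" using \<Omega> by (simp add: bounded_set_imp_lmeasurable)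
  note iO = integrable_indicator_lebesgue_on[OF \<Omega>(1) lm order_refl]
  have i: "integrable (lebesgue_on \<Omega>) (\<lambda>z. A powr r * indicator \<Omega> z)"
    using iO(1) by (rule integrable_mult_right)
  have le: "norm (f z) powr r \<le> A powr r * indicator \<Omega> z" if "z \<in> \<Omega>" for z
    using f(2)[OF that] that r by (simp add: powr_mono2)
  have m: "(\<lambda>z. norm (f z) powr r) \<in> borel_measurable (lebesgue_on \<Omega>)" using f(1) by measurable
  have ir: "integrable (lebesgue_on \<Omega>) (\<lambda>z. norm (f z) powr r)"
    by (rule Bochner_Integration.integrable_bound[OF i m]) (use le in \<open>auto intro!: AE_I2\<close>)
  then show "f \<in> Lp r \<Omega>" using f(1) by (simp add: Lp_def)
  have "(LINT z|lebesgue_on \<Omega>. norm (f z) powr r) \<le> (LINT z|lebesgue_on \<Omega>. A powr r * indicator \<Omega> z)"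
    by (rule integral_mono[OF ir i]) (use le in auto)
  also have "\<dots> = A powr r * measure lebesgue \<Omega>" by (simp only: integral_mult_right_zero iO(2))
  finally have "Lp_norm r \<Omega> f \<le> (A powr r * measure lebesgue \<Omega>) powr (1 / r)"
    unfolding Lp_norm_def using r by (intro powr_mono2) auto
  also have "\<dots> = A * measure lebesgue \<Omega> powr (1 / r)"
    using A r by (simp add: powr_mult powr_powr)
  finally show "Lp_norm r \<Omega> f \<le> A * measure lebesgue \<Omega> powr (1 / r)" .
qed

lemma Lp_norm_1_le_2:
  assumes \<Omega>: "open \<Omega>" "bounded \<Omega>" and g: "g \<in> Lp 2 \<Omega>"
  shows "integrable (lebesgue_on \<Omega>) g" "Lp_norm 1 \<Omega> g \<le> sqrt (measure lebesgue \<Omega> + 1) * Lp_norm 2 \<Omega> g"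
proof -
  have lm: "\<Omega> \<in> lmeasurable" using \<Omega> by (simp add: bounded_set_imp_lmeasurable)
  note iO = integrable_indicator_lebesgue_on[OF \<Omega>(1) lm order_refl]
  have "(\<lambda>z. 1) \<in> Lp 2 \<Omega>" by (rule bounded_measurable_Lp(1)[OF \<Omega>, of _ 1]) auto
  from integrable_mult_Lp_2[OF g this] show ig: "integrable (lebesgue_on \<Omega>) g" by simp
  have i2: "integrable (lebesgue_on \<Omega>) (\<lambda>z. (norm (g z))\<^sup>2)" using g by (simp add: Lp_2_iff)
  define I where "I = (LINT z|lebesgue_on \<Omega>. norm (g z))"
  define J where "J = (LINT z|lebesgue_on \<Omega>. (norm (g z))\<^sup>2)"
  \<comment> \<open>The choice \<open>y = I / V\<close> in \<open>2 x y \<le> x\<^sup>2 + y\<^sup>2\<close> gives the Cauchy-Schwarz inequality after integration;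
      the summand \<open>1\<close> keeps \<open>V\<close> positive.\<close>
  define V where "V = measure lebesgue \<Omega> + 1"
  have V: "V \<ge> 1" by (simp add: V_def)
  have I0: "I \<ge> 0" and J0: "J \<ge> 0" by (simp_all add: I_def J_def)
  have "(LINT z|lebesgue_on \<Omega>. 2 * (I / V) * norm (g z)) \<le> (LINT z|lebesgue_on \<Omega>. (norm (g z))\<^sup>2 + (I / V)\<^sup>2 * indicator \<Omega> z)"
  proof (rule integral_mono)
    show "2 * (I / V) * norm (g z) \<le> (norm (g z))\<^sup>2 + (I / V)\<^sup>2 * indicator \<Omega> z" if "z \<in> space (lebesgue_on \<Omega>)" for z
      using sum_squares_bound[of "I / V" "norm (g z)"] that by simp
  qed (intro integrable_mult_right integrable_norm ig Bochner_Integration.integrable_add i2 iO(1))+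
  also have "\<dots> = J + (I / V)\<^sup>2 * measure lebesgue \<Omega>"
    unfolding J_def using i2 iO by (subst Bochner_Integration.integral_add) auto
  also have "\<dots> \<le> J + (I / V)\<^sup>2 * V" by (simp add: V_def mult_left_mono)
  also have "(I / V)\<^sup>2 * V = I * I / V" using V by (simp add: power2_eq_square)
  finally have "2 * (I / V) * I \<le> J + I * I / V" by (simp add: I_def)
  then have "I * I / V \<le> J" by simp
  then have "I\<^sup>2 \<le> V * J" using V by (simp add: power2_eq_square field_simps)
  then have "I \<le> sqrt (V * J)" by (rule real_le_rsqrt)
  then show "Lp_norm 1 \<Omega> g \<le> sqrt (measure lebesgue \<Omega> + 1) * Lp_norm 2 \<Omega> g"
    unfolding Lp_norm_1 I_def[symmetric] V_def[symmetric]
    using J0 by (simp add: Lp_norm_def J_def powr_half_sqrt real_sqrt_mult)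
qed

text \<open>The values of \<open>f\<close> enter the description of its projection only through inner products with
  \<open>A\<^sup>2(\<Omega>)\<close>.\<close>

lemma bergman_projection_cong:
  assumes "\<And>h k. h \<in> Ap 2 \<Omega> \<Longrightarrow> k \<in> Ap 2 \<Omega> \<Longrightarrow> L2_inner \<Omega> (\<lambda>z. f z - h z) k = L2_inner \<Omega> (\<lambda>z. f' z - h z) k"
  shows "bergman_projection \<Omega> f = bergman_projection \<Omega> f'"
  unfolding bergman_projection_def by (rule arg_cong[where f = The], rule ext, intro conj_cong refl ball_cong) (simp add: assms)

text \<open>The function \<open>H g\<close> is the conjugate of \<open>g\<psi>\<close>, with \<open>\<psi>\<close> vanishing on the boundary to the order \<open>2n\<close>
  that compensates the growth of \<open>g\<close>.\<close>

lemma friedrichs_operator_eq_projection_of_bounded: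
  fixes \<Omega> :: "(complex ^ 'n) set"
  assumes dom: "smoothly_bounded_domain \<Omega>"
  obtains H C where "C \<ge> 0"
    "\<And>g. g \<in> Ap 2 \<Omega> \<Longrightarrow> friedrichs_operator \<Omega> g = bergman_projection \<Omega> (H g)"
    "\<And>g. g \<in> Ap 2 \<Omega> \<Longrightarrow> H g \<in> borel_measurable (lebesgue_on \<Omega>)"
    "\<And>g z. g \<in> Ap 2 \<Omega> \<Longrightarrow> z \<in> \<Omega> \<Longrightarrow> norm (H g z) \<le> C * Lp_norm 1 \<Omega> g"
proof -
  let ?N = "2 * CARD('n)"
  have \<Omega>: "open \<Omega>" "bounded \<Omega>" "\<Omega> \<noteq> {}" using dom by (auto simp: smoothly_bounded_domain_def)
  obtain W s w e where W: "open W" "closure \<Omega> \<subseteq> W" and s0: "Ck_on (Suc ?N) s W"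
    and s: "\<And>z. z \<in> \<Omega> \<Longrightarrow> s z > (0::real)" "\<And>z. z \<in> frontier \<Omega> \<Longrightarrow> s z = 0"
    and we: "\<And>j. Ck_on ?N (w j) W" "Ck_on ?N e W"
      "\<And>z. z \<in> W \<Longrightarrow> (\<Sum>j\<in>UNIV. w j z * dbar j (\<lambda>x. of_real (s x)) z) + of_real (s z) * e z = 1"
    by (rule transversal_fields[OF dom, of ?N]) blast
  have s1: "Ck_on 1 s W" by (rule Ck_on_mono[OF s0]) simp
  obtain b where b: "Ck_on 0 b W" and red: "\<And>h. holomorphic_in h \<Omega> \<Longrightarrow> integrable (lebesgue_on \<Omega>) h \<Longrightarrow>
    (LINT z|lebesgue_on \<Omega>. h z) = (LINT z|lebesgue_on \<Omega>. h z * (of_real (s z) ^ ?N * b z))"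
    using moment_reduction[OF \<Omega>(1,2) W s1 s we order_refl] by auto
  obtain C where C: "C \<ge> 0" "\<And>h z. holomorphic_in h \<Omega> \<Longrightarrow> integrable (lebesgue_on \<Omega>) h \<Longrightarrow> z \<in> \<Omega> \<Longrightarrow>
    norm (h z) * \<bar>s z\<bar> ^ ?N \<le> C * (LINT w|lebesgue_on \<Omega>. norm (h w))"
    using weighted_sup_bound[OF \<Omega> W s1 s(2)] by metis
  have cb: "continuous_on W b" by (rule Ck_on_continuous[OF b])
  obtain M where M: "M \<ge> 0" "\<And>z. z \<in> closure \<Omega> \<Longrightarrow> norm (b z) \<le> M"
    using compact_continuous_bound[of "closure \<Omega>" b] \<Omega>(2) continuous_on_subset[OF cb W(2)] by auto
  define \<psi> where "\<psi> z = of_real (s z) ^ ?N * b z" for z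
  have c\<psi>: "continuous_on W \<psi>" unfolding \<psi>_def
    by (intro continuous_intros cb continuous_on_of_real Ck_on_continuous[OF s1])
  define H where "H g z = cnj (g z * \<psi> z)" for g z
  have hol: "holomorphic_in g \<Omega>" and L2: "g \<in> Lp 2 \<Omega>" if "g \<in> Ap 2 \<Omega>" for g
    using that by (auto simp: Ap_def)
  have ig: "integrable (lebesgue_on \<Omega>) g" if "g \<in> Ap 2 \<Omega>" for g
    by (rule Lp_norm_1_le_2(1)[OF \<Omega>(1,2) L2[OF that]])
  show thesis
  proof (rule that[of "C * M" H])
    show "0 \<le> C * M" using C(1) M(1) by simp
    fix g assume g: "g \<in> Ap 2 \<Omega>"
    show "H g \<in> borel_measurable (lebesgue_on \<Omega>)"
      unfolding H_def
      by (rule borel_measurable_continuous_on[OF continuous_on_cnj[OF continuous_on_id]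
          borel_measurable_integrable[OF integrable_mult_continuous_closure[OF \<Omega>(1,2) ig[OF g] c\<psi> W(2)]]])
    show "norm (H g z) \<le> C * M * Lp_norm 1 \<Omega> g" if z: "z \<in> \<Omega>" for z
    proof -
      have bM: "norm (b z) \<le> M" using M(2) z closure_subset by blast
      have "norm (H g z) = (norm (g z) * \<bar>s z\<bar> ^ ?N) * norm (b z)"
        by (simp only: H_def \<psi>_def complex_mod_cnj norm_mult norm_power norm_of_real ac_simps)
      also have "\<dots> \<le> (C * Lp_norm 1 \<Omega> g) * M"
        unfolding Lp_norm_1
        by (rule mult_mono[OF C(2)[OF hol[OF g] ig[OF g] z] bM]) (simp_all add: C(1))
      finally show ?thesis by (simp only: ac_simps)
    qed
    show "friedrichs_operator \<Omega> g = bergman_projection \<Omega> (H g)"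
      unfolding friedrichs_operator_def
    proof (rule bergman_projection_cong)
      fix h k assume h: "h \<in> Ap 2 \<Omega>" and k: "k \<in> Ap 2 \<Omega>"
      have igk: "integrable (lebesgue_on \<Omega>) (\<lambda>z. g z * k z)" by (rule integrable_mult_Lp_2[OF L2[OF g] L2[OF k]])
      have ihk: "integrable (lebesgue_on \<Omega>) (\<lambda>z. h z * cnj (k z))"
        by (rule integrable_mult_Lp_2[OF L2[OF h] Lp_2_cnj[OF L2[OF k]]])
      have igkp: "integrable (lebesgue_on \<Omega>) (\<lambda>z. g z * k z * \<psi> z)"
        by (rule integrable_mult_continuous_closure[OF \<Omega>(1,2) igk c\<psi> W(2)])
      have A: "integrable (lebesgue_on \<Omega>) (\<lambda>z. cnj (g z * k z))" "integrable (lebesgue_on \<Omega>) (\<lambda>z. cnj (g z * k z * \<psi> z))"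
        using igk igkp by (simp_all only: integrable_cnj)
      have "L2_inner \<Omega> (\<lambda>z. cnj (g z) - h z) k = (LINT z|lebesgue_on \<Omega>. cnj (g z * k z) - h z * cnj (k z))"
        unfolding L2_inner_def by (simp add: left_diff_distrib)
      also have "\<dots> = (LINT z|lebesgue_on \<Omega>. cnj (g z * k z)) - (LINT z|lebesgue_on \<Omega>. h z * cnj (k z))"
        by (rule Bochner_Integration.integral_diff[OF A(1) ihk])
      also have "(LINT z|lebesgue_on \<Omega>. cnj (g z * k z)) = (LINT z|lebesgue_on \<Omega>. cnj (g z * k z * \<psi> z))"
        using red[OF holomorphic_in_mult[OF hol[OF g] hol[OF k]] igk] by (simp only: Bochner_Integration.integral_cnj \<psi>_def)
      also have "\<dots> - (LINT z|lebesgue_on \<Omega>. h z * cnj (k z)) = (LINT z|lebesgue_on \<Omega>. cnj (g z * k z * \<psi> z) - h z * cnj (k z))"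
        by (rule Bochner_Integration.integral_diff[OF A(2) ihk, symmetric])
      also have "\<dots> = L2_inner \<Omega> (\<lambda>z. H g z - h z) k"
        unfolding L2_inner_def H_def by (simp add: algebra_simps)
      finally show "L2_inner \<Omega> (\<lambda>z. cnj (g z) - h z) k = L2_inner \<Omega> (\<lambda>z. H g z - h z) k" .
    qed
  qed
qed

theorem theorem1p1:
  fixes \<Omega> :: "(complex ^ 'n) set" and p :: real
  assumes "smoothly_bounded_domain \<Omega>" and "pseudoconvex \<Omega>" and "p > 2"
    and "\<exists>r\<ge>p. bounded_operator (Lp r \<Omega>) (Lp_norm r \<Omega>) (Ap p \<Omega>) (Lp_norm p \<Omega>)
                  (bergman_projection \<Omega>)"
  shows "bounded_operator (Ap 2 \<Omega>) (Lp_norm 2 \<Omega>) (Ap p \<Omega>) (Lp_norm p \<Omega>)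
           (friedrichs_operator \<Omega>) \<and>
         (\<exists>C>0. \<forall>g\<in>Ap 2 \<Omega>. Lp_norm p \<Omega> (friedrichs_operator \<Omega> g) \<le> C * Lp_norm 1 \<Omega> g)"
proof -
  have \<Omega>: "open \<Omega>" "bounded \<Omega>" using assms(1) by (auto simp: smoothly_bounded_domain_def)
  obtain r B where r: "r \<ge> p" and B: "\<And>f. f \<in> Lp r \<Omega> \<Longrightarrow> bergman_projection \<Omega> f \<in> Ap p \<Omega>"
    "\<And>f. f \<in> Lp r \<Omega> \<Longrightarrow> Lp_norm p \<Omega> (bergman_projection \<Omega> f) \<le> B * Lp_norm r \<Omega> f"
    using assms(4) unfolding bounded_operator_def by blast
  obtain H C where C: "C \<ge> 0" and H: "\<And>g. g \<in> Ap 2 \<Omega> \<Longrightarrow> friedrichs_operator \<Omega> g = bergman_projection \<Omega> (H g)"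
    "\<And>g. g \<in> Ap 2 \<Omega> \<Longrightarrow> H g \<in> borel_measurable (lebesgue_on \<Omega>)"
    "\<And>g z. g \<in> Ap 2 \<Omega> \<Longrightarrow> z \<in> \<Omega> \<Longrightarrow> norm (H g z) \<le> C * Lp_norm 1 \<Omega> g"
    using friedrichs_operator_eq_projection_of_bounded[OF assms(1)] by metis
  \<comment> \<open>\<open>B\<close> may be negative when the norms involved vanish; the summand \<open>1\<close> makes the constant positive.\<close>
  define C1 where "C1 = \<bar>B\<bar> * (C * measure lebesgue \<Omega> powr (1 / r)) + 1"
  have C1: "C1 > 0" unfolding C1_def using mult_nonneg_nonneg[OF abs_ge_zero mult_nonneg_nonneg[OF C powr_ge_zero]]
    by (rule add_nonneg_pos) simp
  have n0: "Lp_norm q \<Omega> f \<ge> 0" for q f by (simp add: Lp_norm_def)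
  have r0: "r > 0" using r assms(3) by linarith
  have main: "friedrichs_operator \<Omega> g \<in> Ap p \<Omega>" "Lp_norm p \<Omega> (friedrichs_operator \<Omega> g) \<le> C1 * Lp_norm 1 \<Omega> g"
    if g: "g \<in> Ap 2 \<Omega>" for g
  proof -
    have A: "C * Lp_norm 1 \<Omega> g \<ge> 0" using C n0 by simp
    note Hr = bounded_measurable_Lp[OF \<Omega> H(2)[OF g] H(3)[OF g] A r0]
    show "friedrichs_operator \<Omega> g \<in> Ap p \<Omega>" unfolding H(1)[OF g] by (rule B(1)[OF Hr(1)])
    have "Lp_norm p \<Omega> (friedrichs_operator \<Omega> g) \<le> B * Lp_norm r \<Omega> (H g)"
      unfolding H(1)[OF g] by (rule B(2)[OF Hr(1)])
    also have "\<dots> \<le> \<bar>B\<bar> * Lp_norm r \<Omega> (H g)" by (intro mult_right_mono n0) simp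
    also have "\<dots> \<le> \<bar>B\<bar> * (C * Lp_norm 1 \<Omega> g * measure lebesgue \<Omega> powr (1 / r))"
      by (rule mult_left_mono[OF Hr(2) abs_ge_zero])
    also have "\<dots> \<le> C1 * Lp_norm 1 \<Omega> g"
      unfolding C1_def using n0[of 1 g] by (simp add: algebra_simps)
    finally show "Lp_norm p \<Omega> (friedrichs_operator \<Omega> g) \<le> C1 * Lp_norm 1 \<Omega> g" .
  qed
  have "Lp_norm p \<Omega> (friedrichs_operator \<Omega> g) \<le> (C1 * sqrt (measure lebesgue \<Omega> + 1)) * Lp_norm 2 \<Omega> g"
    if g: "g \<in> Ap 2 \<Omega>" for g
  proof -
    have "C1 * Lp_norm 1 \<Omega> g \<le> C1 * (sqrt (measure lebesgue \<Omega> + 1) * Lp_norm 2 \<Omega> g)"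
      using g C1 by (intro mult_left_mono Lp_norm_1_le_2 \<Omega>) (auto simp: Ap_def)
    then show ?thesis using main(2)[OF g] by (simp add: mult.assoc)
  qed
  then show ?thesis unfolding bounded_operator_def using main C1 by blast
qed

end
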